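(* Let $V_i=[V_{i,1}\cdots V_{i,n_i}]$, $i\in\{1,\ldots,k\}$, be doubly $\Lambda$-commuting row isometries with $V_{i,m}\in B(\mathcal K)$, let $A=\{i_1,\ldots,i_p\}\subset\{1,\ldots,k\}$ with $A^c=\{j_1,\ldots,j_{k-p}\}$, and let $\mathcal K_A=\big(\bigcap_{i\in A}\mathcal K_i^{(s)}\big)\cap\big(\bigcap_{i\in A^c}\mathcal K_i^{(c)}\big)$. Then there is a unique subspace $\mathcal L_A\subset\mathcal K_A$ that is invariant under all the isometries $V_{j,t}$, $j\in A^c$, $t\in\{1,\ldots,n_j\}$, and such that $$\mathcal K_A=\bigoplus_{\alpha_{i_1}\in\mathbb F_{n_{i_1}}^+,\ldots,\alpha_{i_p}\in\mathbb F_{n_{i_p}}^+}V_{i_1,\alpha_{i_1}}\cdots V_{i_p,\alpha_{i_p}}(\mathcal L_A).$$ Moreover, $$\mathcal L_A=\bigcap_{m_{j_1},\ldots,m_{j_{k-p}}=0}^\infty\Bigg(\bigoplus_{\substack{\alpha_{j_1}\in\mathbb F_{n_{j_1}}^+\\|\alpha_{j_1}|=m_{j_1}}}\cdots\bigoplus_{\substack{\alpha_{j_{k-p}}\in\mathbb F_{n_{j_{k-p}}}^+\\|\alpha_{j_{k-p}}|=m_{j_{k-p}}}}V_{j_1,\alpha_{j_1}}\cdots V_{j_{k-p},\alpha_{j_{k-p}}}\Big(\bigcap_{i\in A,\ s\in\{1,\ldots,n_i\}}\ker V_{i,s}^*\Big)\Bigg).$$ In this case, the following statements hold. (i) If $i\in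 A^c$, then $\mathcal L_A$ is reducing for the isometries $V_{i,m}$, $m\in\{1,\ldots,n_i\}$, and $[V_{i,1}|_{\mathcal L_A}\cdots V_{i,n_i}|_{\mathcal L_A}]$ is a Cuntz row isometry. (ii) If $i,j\in A^c$, $i\ne j$, then $(V_{i,s}|_{\mathcal L_A})^*(V_{j,t}|_{\mathcal L_A})=\overline{\lambda_{i,j}(s,t)}(V_{j,t}|_{\mathcal L_A})(V_{i,s}|_{\mathcal L_A})^*$ for any $s\in\{1,\ldots,n_i\}$, $t\in\{1,\ldots,n_j\}$. (iii) If $i\in A$, then $\mathcal L_A\subset\bigcap_{s\in\{1,\ldots,n_i\}}\ker V_{i,s}^*$. (iv) If $r\in\{1,\ldots,p\}$, $\alpha_{i_1}\in\mathbb F_{n_{i_1}}^+,\ldots,\alpha_{i_p}\in\mathbb F_{n_{i_p}}^+$ and $\beta\in\mathbb F_{n_{i_r}}^+$, then $$V_{i_r,\beta}\big(V_{i_1,\alpha_{i_1}}\cdots V_{i_r,\alpha_{i_r}}\cdots V_{i_p,\alpha_{i_p}}(\mathcal L_A)\big)=V_{i_1,\alpha_{i_1}}\cdots V_{i_r,\beta\alpha_{i_r}}\cdots V_{i_p,\alpha_{i_p}}(\mathcal L_A).$$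
   Context: Fix integers $k\ge1$, $n_1,\ldots,n_k\ge 1$ and, for $i\ne j$ in $\{1,\ldots,k\}$, an $n_i\times n_j$ matrix $\Lambda_{i,j}=[\lambda_{i,j}(s,t)]$ with entries in $\mathbb T=\{z\in\mathbb C:|z|=1\}$, such that $\Lambda_{j,i}=\Lambda_{i,j}^*$, i.e. $\lambda_{j,i}(t,s)=\overline{\lambda_{i,j}(s,t)}$. A row isometry $V_i=[V_{i,1}\cdots V_{i,n_i}]$ on a Hilbert space $\mathcal K$ consists of $V_{i,s}\in B(\mathcal K)$ with $V_{i,s}^*V_{i,t}=\delta_{st}I$; it is Cuntz if $\sum_sV_{i,s}V_{i,s}^*=I$. Row isometries $V_1,\ldots,V_k$ on $\mathcal K$ are doubly $\Lambda$-commuting if $V_{i,s}^*V_{j,t}=\overline{\lambda_{i,j}(s,t)}\,V_{j,t}V_{i,s}^*$ for all $i\neq j$, $s\in\{1,\ldots,n_i\}$, $t\in\{1,\ldots,n_j\}$. $\mathbb F_{n_i}^+$ is the unital free semigroup with generators $g_1^i,\ldots,g_{n_i}^i$ and neutral element $g_0^i$; $|\alpha|$ is word length; $V_{i,\alpha}:=V_{i,p_1}\cdots V_{i,p_m}$ for $\alpha=g^i_{p_1}\cdots g^i_{p_m}$ and $V_{i,g_0^i}:=I$. $\mathcal K_i^{(s)}:=\bigoplus_{\alpha\in\mathbb F_{n_i}^+}V_{i,\alpha}\big(\bigcap_{m=1}^{n_i}\ker V_{i,m}^*\big)$ and $\mathcal K_i^{(c)}:=\bigcap_{p=0}^\infty\big(\bigoplus_{|\alpha|=p}V_{i,\alpha}\mathcal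 K\big)$. $A^c$ is the complement of $A$ in $\{1,\ldots,k\}$. Subspaces are closed and may be zero. Conventions in the extreme cases: if $A=\emptyset$, the intersection of kernels is $\mathcal K$ and $\mathcal K_\emptyset=\mathcal L_\emptyset$; if $A=\{1,\ldots,k\}$, then $\mathcal L_A=\bigcap_{i,s}\ker V_{i,s}^*$. *)

theory Defs
  imports "HOL-Analysis.Analysis"
begin

section \<open>Complex Hilbert spaces\<close>

text \<open>The inner product is linear in the first argument. The space may be trivial or non-separable.\<close>

class complex_hilbert_space = banach +
  fixes scaleC :: "complex \<Rightarrow> 'a \<Rightarrow> 'a"
    and cinner :: "'a \<Rightarrow> 'a \<Rightarrow> complex"
  assumes scaleC_add_right: "scaleC c (x + y) = scaleC c x + scaleC c y"
    and scaleC_add_left: "scaleC (c + d) x = scaleC c x + scaleC d x"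
    and scaleC_scaleC: "scaleC c (scaleC d x) = scaleC (c * d) x"
    and scaleC_one: "scaleC 1 x = x"
    and scaleR_scaleC: "scaleR r x = scaleC (complex_of_real r) x"
    and cinner_commute: "cinner x y = cnj (cinner y x)"
    and cinner_add_left: "cinner (x + y) z = cinner x z + cinner y z"
    and cinner_scaleC_left: "cinner (scaleC c x) y = c * cinner x y"
    and cinner_self: "cinner x x = complex_of_real ((norm x)\<^sup>2)"

instantiation complex :: complex_hilbert_space
begin

definition scaleC_complex :: "complex \<Rightarrow> complex \<Rightarrow> complex"
  where "scaleC_complex c x = c * x"

definition cinner_complex :: "complex \<Rightarrow> complex \<Rightarrow> complex"
  where "cinner_complex x y = x * cnj y"

instance
proof
  fix x :: complex
  show "cinner x x = complex_of_real ((norm x)\<^sup>2)"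
    unfolding cinner_complex_def by (rule complex_norm_square [symmetric])
qed (auto simp: scaleC_complex_def cinner_complex_def distrib_left distrib_right scaleR_conv_of_real)

end

global_interpretation complex_vector:
  vector_space "scaleC :: complex \<Rightarrow> 'a \<Rightarrow> 'a::complex_hilbert_space"
  defines csubspace = complex_vector.subspace
    and cspan = complex_vector.span
  by unfold_locales (rule scaleC_add_right scaleC_add_left scaleC_scaleC scaleC_one)+

definition closed_csubspace :: "'a::complex_hilbert_space set \<Rightarrow> bool"
  where "closed_csubspace M \<longleftrightarrow> csubspace M \<and> closed M"

text \<open>The internal Hilbert space direct sum of a family of subspaces is the closed linear span of
  a pairwise orthogonal family. \<open>hilbert_sum\<close> forms the closed span;
  orthogonality is the separate predicate \<open>orthogonal_family\<close>.\<close>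

definition hilbert_sum :: "'i set \<Rightarrow> ('i \<Rightarrow> 'a::complex_hilbert_space set) \<Rightarrow> 'a set"
  where "hilbert_sum I F = closure (cspan (\<Union>i\<in>I. F i))"

definition orthogonal_family :: "'i set \<Rightarrow> ('i \<Rightarrow> 'a::complex_hilbert_space set) \<Rightarrow> bool"
  where "orthogonal_family I F \<longleftrightarrow>
    (\<forall>i\<in>I. \<forall>j\<in>I. i \<noteq> j \<longrightarrow> (\<forall>x\<in>F i. \<forall>y\<in>F j. cinner x y = 0))"

section \<open>Operators on a closed subspace\<close>

text \<open>Operators are treated relative to a closed subspace \<open>M\<close>, regarded as a Hilbert space in its
  own right; only their values on \<open>M\<close> matter. Thus the restriction of \<open>T\<close> to \<open>M\<close> is represented
  by \<open>T\<close> itself, \<open>adj_on M T\<close> is the adjoint \<open>(T|M)\<^sup>*\<close> in \<open>B(M)\<close> (not the restriction of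
  the adjoint on the whole space), and \<open>M = UNIV\<close> gives the operators on the whole space.\<close>

definition bounded_op_on :: "'a::complex_hilbert_space set \<Rightarrow> ('a \<Rightarrow> 'a) \<Rightarrow> bool"
  where "bounded_op_on M T \<longleftrightarrow>
    (\<forall>x\<in>M. T x \<in> M) \<and>
    (\<forall>x\<in>M. \<forall>y\<in>M. T (x + y) = T x + T y) \<and>
    (\<forall>c. \<forall>x\<in>M. T (scaleC c x) = scaleC c (T x)) \<and>
    (\<exists>B. \<forall>x\<in>M. norm (T x) \<le> B * norm x)"

text \<open>For \<open>M\<close> a closed subspace, \<open>bounded_op_on M T\<close> and \<open>x \<in> M\<close>, the description below has
  exactly one solution, by the Riesz representation theorem in \<open>M\<close>.\<close>

definition adj_on :: "'a::complex_hilbert_space set \<Rightarrow> ('a \<Rightarrow> 'a) \<Rightarrow> 'a \<Rightarrow> 'a"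
  where "adj_on M T x = (THE z. z \<in> M \<and> (\<forall>y\<in>M. cinner z y = cinner x (T y)))"

abbreviation adj :: "('a::complex_hilbert_space \<Rightarrow> 'a) \<Rightarrow> 'a \<Rightarrow> 'a"
  where "adj \<equiv> adj_on UNIV"

definition reducing_for :: "'a::complex_hilbert_space set \<Rightarrow> ('a \<Rightarrow> 'a) \<Rightarrow> bool"
  where "reducing_for M T \<longleftrightarrow> (\<forall>x\<in>M. T x \<in> M) \<and> (\<forall>x\<in>M. adj T x \<in> M)"

section \<open>Row isometries\<close>

definition row_isometry_on ::
    "'a::complex_hilbert_space set \<Rightarrow> nat \<Rightarrow> (nat \<Rightarrow> 'a \<Rightarrow> 'a) \<Rightarrow> bool"
  where "row_isometry_on M n V \<longleftrightarrow>
    (\<forall>s\<in>{1..n}. bounded_op_on M (V s)) \<and>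
    (\<forall>s\<in>{1..n}. \<forall>t\<in>{1..n}. \<forall>x\<in>M. adj_on M (V s) (V t x) = (if s = t then x else 0))"

definition cuntz_row_isometry_on ::
    "'a::complex_hilbert_space set \<Rightarrow> nat \<Rightarrow> (nat \<Rightarrow> 'a \<Rightarrow> 'a) \<Rightarrow> bool"
  where "cuntz_row_isometry_on M n V \<longleftrightarrow>
    row_isometry_on M n V \<and> (\<forall>x\<in>M. (\<Sum>s\<in>{1..n}. V s (adj_on M (V s) x)) = x)"

text \<open>\<open>lam i j s t\<close> is the \<open>(s, t)\<close> entry of the matrix with index \<open>(i, j)\<close>.\<close>

definition Lambda_system ::
    "nat \<Rightarrow> (nat \<Rightarrow> nat) \<Rightarrow> (nat \<Rightarrow> nat \<Rightarrow> nat \<Rightarrow> nat \<Rightarrow> complex) \<Rightarrow> bool"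
  where "Lambda_system k n lam \<longleftrightarrow>
    (\<forall>i\<in>{1..k}. \<forall>j\<in>{1..k}. i \<noteq> j \<longrightarrow> (\<forall>s\<in>{1..n i}. \<forall>t\<in>{1..n j}.
      cmod (lam i j s t) = 1 \<and> lam j i t s = cnj (lam i j s t)))"

definition doubly_commuting_on ::
    "'a::complex_hilbert_space set \<Rightarrow> nat set \<Rightarrow> (nat \<Rightarrow> nat) \<Rightarrow>
      (nat \<Rightarrow> nat \<Rightarrow> nat \<Rightarrow> nat \<Rightarrow> complex) \<Rightarrow> (nat \<Rightarrow> nat \<Rightarrow> 'a \<Rightarrow> 'a) \<Rightarrow> bool"
  where "doubly_commuting_on M S n lam V \<longleftrightarrow>
    (\<forall>i\<in>S. \<forall>j\<in>S. i \<noteq> j \<longrightarrow> (\<forall>s\<in>{1..n i}. \<forall>t\<in>{1..n j}. \<forall>x\<in>M.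
      adj_on M (V i s) (V j t x) =
      scaleC (cnj (lam i j s t)) (V j t (adj_on M (V i s) x))))"

section \<open>Words and the Wold-type subspaces\<close>

text \<open>The free semigroup on \<open>n\<close> generators is \<open>lists {1..n}\<close> with concatenation.\<close>

abbreviation words :: "nat \<Rightarrow> nat list set"
  where "words n \<equiv> lists {1..n}"

definition word_op :: "(nat \<Rightarrow> 'a \<Rightarrow> 'a) \<Rightarrow> nat list \<Rightarrow> 'a \<Rightarrow> 'a"
  where "word_op V \<alpha> = foldr (\<lambda>s T. V s \<circ> T) \<alpha> id"

text \<open>A tuple of words indexed by \<open>A\<close> is an extensional function on \<open>A\<close>; extensionality makes
  tuples correspond one-to-one to summands in the direct sums. For \<open>il = [i1, ..., ip]\<close>,
  \<open>multi_op V il \<alpha>\<close> is the product of the \<open>word_op (V i) (\<alpha> i)\<close> in the order of the list.\<close>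

abbreviation word_tuples :: "(nat \<Rightarrow> nat) \<Rightarrow> nat set \<Rightarrow> (nat \<Rightarrow> nat list) set"
  where "word_tuples n A \<equiv> (\<Pi>\<^sub>E i\<in>A. words (n i))"

definition multi_op ::
    "(nat \<Rightarrow> nat \<Rightarrow> 'a \<Rightarrow> 'a) \<Rightarrow> nat list \<Rightarrow> (nat \<Rightarrow> nat list) \<Rightarrow> 'a \<Rightarrow> 'a"
  where "multi_op V il \<alpha> = foldr (\<lambda>i T. word_op (V i) (\<alpha> i) \<circ> T) il id"

definition common_ker :: "nat \<Rightarrow> (nat \<Rightarrow> 'a::complex_hilbert_space \<Rightarrow> 'a) \<Rightarrow> 'a set"
  where "common_ker n V = (\<Inter>s\<in>{1..n}. {x. adj (V s) x = 0})"

definition shift_part :: "nat \<Rightarrow> (nat \<Rightarrow> 'a::complex_hilbert_space \<Rightarrow> 'a) \<Rightarrow> 'a set"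
  where "shift_part n V = hilbert_sum (words n) (\<lambda>\<alpha>. word_op V \<alpha> ` common_ker n V)"

definition cuntz_part :: "nat \<Rightarrow> (nat \<Rightarrow> 'a::complex_hilbert_space \<Rightarrow> 'a) \<Rightarrow> 'a set"
  where "cuntz_part n V =
    (\<Inter>p. hilbert_sum {\<alpha> \<in> words n. length \<alpha> = p} (\<lambda>\<alpha>. word_op V \<alpha> ` UNIV))"

definition joint_part ::
    "nat \<Rightarrow> (nat \<Rightarrow> nat) \<Rightarrow> (nat \<Rightarrow> nat \<Rightarrow> 'a::complex_hilbert_space \<Rightarrow> 'a) \<Rightarrow> nat set \<Rightarrow> 'a set"
  where "joint_part k n V A =
    (\<Inter>i\<in>A. shift_part (n i) (V i)) \<inter> (\<Inter>i\<in>{1..k} - A. cuntz_part (n i) (V i))"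

text \<open>\<open>L\<close> generates the joint part of \<open>A = set il\<close>, where \<open>il\<close> enumerates \<open>A\<close>.\<close>

definition generates_joint_part ::
    "nat \<Rightarrow> (nat \<Rightarrow> nat) \<Rightarrow> (nat \<Rightarrow> nat \<Rightarrow> 'a::complex_hilbert_space \<Rightarrow> 'a) \<Rightarrow> nat list \<Rightarrow>
      'a set \<Rightarrow> bool"
  where "generates_joint_part k n V il L \<longleftrightarrow>
    closed_csubspace L \<and>
    L \<subseteq> joint_part k n V (set il) \<and>
    (\<forall>j\<in>{1..k} - set il. \<forall>t\<in>{1..n j}. V j t ` L \<subseteq> L) \<and>
    orthogonal_family (word_tuples n (set il)) (\<lambda>\<alpha>. multi_op V il \<alpha> ` L) \<and>
    joint_part k n V (set il) =
      hilbert_sum (word_tuples n (set il)) (\<lambda>\<alpha>. multi_op V il \<alpha> ` L)"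

end

theory Submission
  imports Defs
begin

text \<open>Let \<open>N\<close> be the intersection of the kernels of the \<open>adj (V i s)\<close>, \<open>i \<in> A\<close>, and \<open>K\<close> the joint
  part. The Cuntz part of a row isometry is the orthogonal complement of its shift part, and double
  commutation makes all these subspaces, as well as the kernels of the other rows, reducing. Hence
  the one-row Wold decomposition, applied to a reducing subspace of the shift part, can be iterated
  over \<open>A\<close> and shows that \<open>K \<inter> N\<close> generates \<open>K\<close>. Conversely, a generating \<open>L\<close> is orthogonal to every
  \<open>V i s ` K\<close> with \<open>i \<in> A\<close>, so \<open>L \<subseteq> K \<inter> N\<close>; the part of \<open>K \<inter> N\<close> orthogonal to \<open>L\<close> is orthogonal
  to \<open>K\<close>, so \<open>L = K \<inter> N\<close>. On \<open>L\<close> the rows outside \<open>A\<close> are Cuntz, which gives the intersection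
  formula.\<close>

section \<open>Geometry of complex Hilbert spaces\<close>

text \<open>Only relations between \<open>adj (V i s)\<close> and \<open>V j t\<close> are assumed.
  Moving words of one row past another also needs a relation between \<open>V i s\<close> and
  \<open>V j t\<close>; it follows because the entries have modulus one and the operators are
  isometric. For the invariance of subspaces the exact entries are immaterial, since a subspace
  absorbs nonzero scalars; hence the form \<open>scalar_commute\<close>. Vectors are never expanded
  in infinite series: a sum is bounded above by checking its summands, and bounded below by finite
  expansions or by showing that nothing orthogonal to it remains. The kernel of row \<open>i\<close>
  reduces the other rows but in general not row \<open>i\<close> itself. The induction over
  \<open>A\<close> therefore replaces a subspace by its intersection with the kernel of the row just
  treated, and the enumerating list must be distinct. Uniqueness rests on the orthogonality of the
  summands: prepending a letter to the word of row \<open>i\<close> never gives the tuple of empty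
  words, so \<open>V i s\<close> maps every summand to one orthogonal to \<open>L\<close>.\<close>

lemma cinner_add_right: "cinner x (y + z) = cinner x y + cinner x z"
  for x :: "'a::complex_hilbert_space"
  by (metis cinner_add_left cinner_commute complex_cnj_add)

lemma cinner_scaleC_right: "cinner x (scaleC c y) = cnj c * cinner x y"
  for x :: "'a::complex_hilbert_space"
  by (metis cinner_commute cinner_scaleC_left complex_cnj_mult)

lemma cinner_zero_left [simp]: "cinner 0 x = 0" for x :: "'a::complex_hilbert_space"
  using cinner_add_left [of 0 0 x] by simp

lemma cinner_zero_right [simp]: "cinner x 0 = 0" for x :: "'a::complex_hilbert_space"
  using cinner_add_right [of x 0 0] by simp

lemma cinner_diff_left: "cinner (x - y) z = cinner x z - cinner y z"
  for x :: "'a::complex_hilbert_space"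
  using cinner_add_left [of "x - y" y z] by simp

lemma cinner_diff_right: "cinner z (x - y) = cinner z x - cinner z y"
  for x :: "'a::complex_hilbert_space"
  using cinner_add_right [of z "x - y" y] by simp

lemma cinner_sum_left: "cinner (\<Sum>s\<in>S. f s) z = (\<Sum>s\<in>S. cinner (f s) z)"
  for z :: "'a::complex_hilbert_space"
  by (induction S rule: infinite_finite_induct) (auto simp: cinner_add_left)

lemma cinner_self_eq_0 [simp]: "cinner x x = 0 \<longleftrightarrow> x = 0" for x :: "'a::complex_hilbert_space"
  by (simp add: cinner_self)

lemma cinner_eq_0_commute: "cinner x y = 0 \<Longrightarrow> cinner y x = 0"
  for x :: "'a::complex_hilbert_space"
  by (metis cinner_commute complex_cnj_zero)

lemma cinner_extensionality: "(\<And>y. cinner x y = cinner z y) \<Longrightarrow> x = z"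
  for x :: "'a::complex_hilbert_space"
  by (metis cinner_diff_left cinner_self_eq_0 right_minus_eq)

lemma power2_norm_cinner: "(norm x)\<^sup>2 = Re (cinner x x)" for x :: "'a::complex_hilbert_space"
  by (simp add: cinner_self)

lemma norm_scaleC: "norm (scaleC c x) = cmod c * norm x" for x :: "'a::complex_hilbert_space"
proof -
  have "complex_of_real ((norm (scaleC c x))\<^sup>2) = (c * cnj c) * cinner x x"
    unfolding cinner_self [symmetric] by (simp add: cinner_scaleC_left cinner_scaleC_right)
  also have "\<dots> = complex_of_real ((cmod c * norm x)\<^sup>2)"
    by (simp add: cinner_self complex_norm_square [symmetric] power_mult_distrib del: of_real_power)
  finally have "(norm (scaleC c x))\<^sup>2 = (cmod c * norm x)\<^sup>2"
    using of_real_eq_iff by blast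
  then show ?thesis
    by (simp add: power2_eq_iff_nonneg)
qed

text \<open>Pythagoras for the component of \<open>x\<close> along \<open>y\<close>. Nonnegativity
  of the left side gives the Cauchy-Schwarz inequality; minimality of a distance turns the same
  identity into orthogonality.\<close>

lemma power2_norm_diff_projection:
  fixes x y :: "'a::complex_hilbert_space"
  assumes "y \<noteq> 0"
  defines "c \<equiv> cinner x y / complex_of_real ((norm y)\<^sup>2)"
  shows "(norm (x - scaleC c y))\<^sup>2 = (norm x)\<^sup>2 - (cmod (cinner x y))\<^sup>2 / (norm y)\<^sup>2"
proof -
  have ny: "complex_of_real ((norm y)\<^sup>2) \<noteq> 0"
    using assms by simp
  have yx: "cinner y x = cnj (cinner x y)"
    by (rule cinner_commute)
  have cy: "c * cinner y y = cinner x y"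
    using ny by (simp add: c_def cinner_self)
  have "complex_of_real ((norm (x - scaleC c y))\<^sup>2) =
      cinner x x - cnj c * cinner x y - c * cinner y x + cnj c * (c * cinner y y)"
    unfolding cinner_self [symmetric]
    by (simp add: cinner_diff_left cinner_diff_right cinner_scaleC_left cinner_scaleC_right
        algebra_simps)
  also have "\<dots> = cinner x x - c * cinner y x"
    by (simp add: cy)
  also have "c * cinner y x = complex_of_real ((cmod (cinner x y))\<^sup>2 / (norm y)\<^sup>2)"
    unfolding yx c_def by (simp add: complex_norm_square [symmetric] del: of_real_power)
  finally have "complex_of_real ((norm (x - scaleC c y))\<^sup>2) =
      complex_of_real ((norm x)\<^sup>2 - (cmod (cinner x y))\<^sup>2 / (norm y)\<^sup>2)"
    by (simp add: cinner_self)
  then show ?thesis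
    using of_real_eq_iff by blast
qed

lemma norm_cinner_le: "cmod (cinner x y) \<le> norm x * norm y"
  for x y :: "'a::complex_hilbert_space"
proof (cases "y = 0")
  case False
  have "0 \<le> (norm x)\<^sup>2 - (cmod (cinner x y))\<^sup>2 / (norm y)\<^sup>2"
    using power2_norm_diff_projection [OF False, of x] by (metis zero_le_power2)
  then have "(cmod (cinner x y))\<^sup>2 \<le> (norm x * norm y)\<^sup>2"
    using False by (simp add: field_simps power_mult_distrib)
  then show ?thesis
    by (rule power2_le_imp_le) simp
qed simp

lemma bounded_linear_cinner_left: "bounded_linear (\<lambda>x. cinner x y)"
  for y :: "'a::complex_hilbert_space"
  by (rule bounded_linear_intro [where K = "norm y"])
    (auto simp: cinner_add_left cinner_scaleC_left scaleR_scaleC [where 'a = 'a] norm_cinner_le scaleR_conv_of_real)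

lemma bounded_linear_scaleC: "bounded_linear (scaleC c :: 'a \<Rightarrow> 'a::complex_hilbert_space)"
  by (rule bounded_linear_intro [where K = "cmod c"])
    (auto simp: scaleC_add_right norm_scaleC scaleR_scaleC scaleC_scaleC mult.commute)

lemma parallelogram_law:
  "(norm (x + y))\<^sup>2 + (norm (x - y))\<^sup>2 = 2 * (norm x)\<^sup>2 + 2 * (norm y)\<^sup>2"
  for x y :: "'a::complex_hilbert_space"
  by (simp add: power2_norm_cinner cinner_add_left cinner_add_right cinner_diff_left
      cinner_diff_right)

section \<open>Closed subspaces, nearest points and orthogonal complements\<close>

lemma csubspace_0: "csubspace M \<Longrightarrow> 0 \<in> M"
  and csubspace_add: "csubspace M \<Longrightarrow> x \<in> M \<Longrightarrow> y \<in> M \<Longrightarrow> x + y \<in> M"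
  and csubspace_scaleC: "csubspace M \<Longrightarrow> x \<in> M \<Longrightarrow> scaleC c x \<in> M"
  and csubspace_diff: "csubspace M \<Longrightarrow> x \<in> M \<Longrightarrow> y \<in> M \<Longrightarrow> x - y \<in> M"
  by (auto intro: complex_vector.subspace_0 complex_vector.subspace_add
      complex_vector.subspace_scale complex_vector.subspace_diff)

lemma csubspaceI:
  assumes "0 \<in> M" "\<And>x y. x \<in> M \<Longrightarrow> y \<in> M \<Longrightarrow> x + y \<in> M" "\<And>c x. x \<in> M \<Longrightarrow> scaleC c x \<in> M"
  shows "csubspace M"
  using assms by (simp add: complex_vector.subspace_def)

lemma closed_csubspaceD: "closed_csubspace M \<Longrightarrow> csubspace M" "closed_csubspace M \<Longrightarrow> closed M"
  by (auto simp: closed_csubspace_def)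

lemma closed_csubspace_UNIV: "closed_csubspace UNIV"
  by (auto simp: closed_csubspace_def intro: csubspaceI)

lemma closed_csubspace_Int:
  "closed_csubspace M \<Longrightarrow> closed_csubspace N \<Longrightarrow> closed_csubspace (M \<inter> N)"
  by (auto simp: closed_csubspace_def intro: complex_vector.subspace_inter)

lemma closed_csubspace_INT:
  "(\<And>i. i \<in> I \<Longrightarrow> closed_csubspace (F i)) \<Longrightarrow> closed_csubspace (\<Inter>i\<in>I. F i)"
  by (auto simp: closed_csubspace_def intro!: complex_vector.subspace_Inter)

lemma closest_point_in_closed_csubspace:
  fixes M :: "'a::complex_hilbert_space set"
  assumes M: "closed_csubspace M"
  obtains m where "m \<in> M" "\<And>y. y \<in> M \<Longrightarrow> norm (x - m) \<le> norm (x - y)"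
proof -
  define D where "D = (\<lambda>y. (norm (x - y))\<^sup>2) ` M"
  define d where "d = Inf D"
  have sub: "csubspace M" and cl: "closed M"
    using M by (auto simp: closed_csubspace_def)
  have ne: "D \<noteq> {}"
    using csubspace_0 [OF sub] by (auto simp: D_def)
  have bdd: "bdd_below D"
    by (auto simp: D_def intro!: bdd_belowI [of _ 0])
  have d_le: "d \<le> (norm (x - y))\<^sup>2" if "y \<in> M" for y
    unfolding d_def by (rule cInf_lower [OF _ bdd]) (use that in \<open>auto simp: D_def\<close>)
  have "\<exists>y\<in>M. (norm (x - y))\<^sup>2 < d + 1 / real (Suc n)" for n
  proof -
    have "Inf D < d + 1 / real (Suc n)"
      by (simp add: d_def)
    then show ?thesis
      using cInf_lessD [OF ne] by (auto simp: D_def)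
  qed
  then obtain y where yM: "\<And>n. y n \<in> M" and y: "\<And>n. (norm (x - y n))\<^sup>2 < d + 1 / real (Suc n)"
    by metis
  \<comment> \<open>The midpoint of \<open>y p\<close> and \<open>y q\<close> lies in
    \<open>M\<close>, so its squared distance to \<open>x\<close> is at least \<open>d\<close>. In
    the parallelogram law the four copies of \<open>d\<close> then cancel and only the two error
    terms survive.\<close>
  have close: "(norm (y p - y q))\<^sup>2 \<le> 2 / real (Suc p) + 2 / real (Suc q)" for p q
  proof -
    define z where "z = scaleC (1/2) (y p + y q)"
    have "z \<in> M"
      by (simp add: z_def csubspace_scaleC csubspace_add sub yM)
    have two: "v + v = scaleC 2 v" for v :: 'a
      using scaleC_add_left [of 1 1 v] by (simp add: scaleC_one)
    have "(x - y p) + (x - y q) = scaleC 2 (x - z)"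
      by (simp add: z_def complex_vector.scale_right_diff_distrib scaleC_scaleC scaleC_one
          two [symmetric])
    then have "(norm ((x - y p) + (x - y q)))\<^sup>2 = 4 * (norm (x - z))\<^sup>2"
      by (simp add: norm_scaleC power_mult_distrib)
    moreover have "norm ((x - y p) - (x - y q)) = norm (y p - y q)"
      by (simp add: norm_minus_commute)
    ultimately have "4 * (norm (x - z))\<^sup>2 + (norm (y p - y q))\<^sup>2 =
        2 * (norm (x - y p))\<^sup>2 + 2 * (norm (x - y q))\<^sup>2"
      using parallelogram_law [of "x - y p" "x - y q"] by simp
    then show ?thesis
      using d_le [OF \<open>z \<in> M\<close>] y [of p] y [of q] by simp
  qed
  have "Cauchy y"
  proof (rule metric_CauchyI)
    fix e :: real
    assume "0 < e"
    then obtain N :: nat where "real N > 4 / e\<^sup>2"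
      using reals_Archimedean2 by blast
    with \<open>0 < e\<close> have N: "4 / real (Suc N) < e\<^sup>2"
      by (simp add: field_simps add_strict_increasing)
    have "dist (y p) (y q) < e" if "p \<ge> N" "q \<ge> N" for p q
    proof -
      have "2 / real (Suc r) \<le> 2 / real (Suc N)" if "r \<ge> N" for r
        using that by (intro divide_left_mono) auto
      from this [OF \<open>p \<ge> N\<close>] this [OF \<open>q \<ge> N\<close>] have "(norm (y p - y q))\<^sup>2 < e\<^sup>2"
        using close [of p q] N by linarith
      then show ?thesis
        using \<open>0 < e\<close> by (simp add: dist_norm power_less_imp_less_base)
    qed
    then show "\<exists>N. \<forall>p\<ge>N. \<forall>q\<ge>N. dist (y p) (y q) < e"
      by blast
  qed
  then obtain m where lim: "y \<longlonglongrightarrow> m"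
    by (auto simp: Cauchy_convergent_iff convergent_def)
  have "m \<in> M"
    using cl lim yM closed_sequentially by blast
  moreover have "norm (x - m) \<le> norm (x - v)" if "v \<in> M" for v
  proof -
    have "(\<lambda>n. (norm (x - y n))\<^sup>2) \<longlonglongrightarrow> (norm (x - m))\<^sup>2"
      by (intro tendsto_intros lim)
    moreover have "(\<lambda>n. d + 1 / real (Suc n)) \<longlonglongrightarrow> d + 0"
      by (intro tendsto_add tendsto_const LIMSEQ_Suc lim_1_over_n)
    ultimately have "(norm (x - m))\<^sup>2 \<le> d + 0"
      by (rule LIMSEQ_le) (use y less_imp_le in blast)
    then have "(norm (x - m))\<^sup>2 \<le> (norm (x - v))\<^sup>2"
      using d_le [OF that] by linarith
    then show ?thesis
      by (rule power2_le_imp_le) simp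
  qed
  ultimately show ?thesis
    by (rule that)
qed

definition ocompl :: "'a::complex_hilbert_space set \<Rightarrow> 'a set"
  where "ocompl S = {x. \<forall>y\<in>S. cinner x y = 0}"

lemma closed_csubspace_ocompl: "closed_csubspace (ocompl S)"
proof -
  have "ocompl S = (\<Inter>y\<in>S. {x. cinner x y = 0})"
    by (auto simp: ocompl_def)
  moreover have "closed {x. cinner x y = 0}" for y :: 'a
    by (intro closed_Collect_eq continuous_on_const
        linear_continuous_on bounded_linear_cinner_left)
  ultimately have "closed (ocompl S)"
    by (simp add: closed_INT)
  moreover have "csubspace (ocompl S)"
    by (rule csubspaceI) (auto simp: ocompl_def cinner_add_left cinner_scaleC_left)
  ultimately show ?thesis
    by (simp add: closed_csubspace_def)
qed

lemma orthogonal_decomposition: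
  fixes M :: "'a::complex_hilbert_space set"
  assumes M: "closed_csubspace M"
  obtains m u where "m \<in> M" "u \<in> ocompl M" "x = m + u"
proof -
  obtain m where m: "m \<in> M" and min: "\<And>y. y \<in> M \<Longrightarrow> norm (x - m) \<le> norm (x - y)"
    by (rule closest_point_in_closed_csubspace [OF M, of x]) blast
  have sub: "csubspace M"
    using M by (rule closed_csubspaceD)
  have "cinner (x - m) y = 0" if "y \<in> M" for y
  proof (cases "y = 0")
    case False
    define c where "c = cinner (x - m) y / complex_of_real ((norm y)\<^sup>2)"
    \<comment> \<open>A nonzero inner product with \<open>y\<close> would let this competitor come
      strictly closer to \<open>x\<close> than \<open>m\<close>.\<close>
    have "m + scaleC c y \<in> M"
      by (simp add: csubspace_add csubspace_scaleC sub m that)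
    from min [OF this] have "norm (x - m) \<le> norm (x - m - scaleC c y)"
      by (simp add: diff_diff_eq)
    then have "(norm (x - m))\<^sup>2 \<le> (norm (x - m - scaleC c y))\<^sup>2"
      by (simp add: power_mono)
    then have "(cmod (cinner (x - m) y))\<^sup>2 / (norm y)\<^sup>2 \<le> 0"
      using power2_norm_diff_projection [OF False, of "x - m"] unfolding c_def by linarith
    then show ?thesis
      using False by (simp add: divide_le_0_iff)
  qed simp
  then have "x - m \<in> ocompl M"
    by (simp add: ocompl_def)
  with m show ?thesis
    using that [of m "x - m"] by simp
qed

lemma ocompl_self_eq_0: "x \<in> M \<Longrightarrow> x \<in> ocompl M \<Longrightarrow> x = 0"
  by (auto simp: ocompl_def)

section \<open>Hilbert sums as least closed subspaces\<close>

lemma closed_csubspace_hilbert_sum: "closed_csubspace (hilbert_sum I F)"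
proof -
  define S where "S = cspan (\<Union>i\<in>I. F i)"
  have S: "csubspace S"
    by (simp add: S_def complex_vector.subspace_span)
  have "csubspace (closure S)"
  proof (rule csubspaceI)
    show "0 \<in> closure S"
      using csubspace_0 [OF S] closure_subset by blast
    show "scaleC c x \<in> closure S" if "x \<in> closure S" for c x
    proof -
      have "scaleC c ` closure S \<subseteq> closure S"
        by (rule image_closure_subset)
          (use closure_subset csubspace_scaleC [OF S] in
            \<open>auto intro: linear_continuous_on bounded_linear_scaleC\<close>)
      with that show ?thesis
        by blast
    qed
    show "x + y \<in> closure S" if xy: "x \<in> closure S" "y \<in> closure S" for x y
    proof -
      obtain f where "\<And>n. f n \<in> S" "f \<longlonglongrightarrow> x"
        using xy(1) unfolding closure_sequential by blast
      moreover obtain g where "\<And>n. g n \<in> S" "g \<longlonglongrightarrow> y"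
        using xy(2) unfolding closure_sequential by blast
      ultimately have "\<And>n. f n + g n \<in> S" "(\<lambda>n. f n + g n) \<longlonglongrightarrow> x + y"
        using csubspace_add [OF S] by (auto intro: tendsto_add)
      then show ?thesis
        unfolding closure_sequential by (intro exI [of _ "\<lambda>n. f n + g n"]) simp
    qed
  qed
  then show ?thesis
    by (simp add: closed_csubspace_def hilbert_sum_def S_def)
qed

lemma hilbert_sum_upper: "i \<in> I \<Longrightarrow> F i \<subseteq> hilbert_sum I F"
  unfolding hilbert_sum_def
  using complex_vector.span_superset [of "\<Union>i\<in>I. F i"]
    closure_subset [of "cspan (\<Union>i\<in>I. F i)"] by (meson UN_upper order_trans)

text \<open>With \<open>hilbert_sum_upper\<close> this characterizes the sum as the least closed
  subspace containing its summands. Later arguments use this property instead of closures and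
  spans.\<close>

lemma hilbert_sum_least:
  assumes "closed_csubspace M" and "\<And>i. i \<in> I \<Longrightarrow> F i \<subseteq> M"
  shows "hilbert_sum I F \<subseteq> M"
  unfolding hilbert_sum_def using assms
  by (intro closure_minimal complex_vector.span_minimal) (auto simp: closed_csubspace_def)

lemma hilbert_sum_mono:
  assumes "\<And>i x. i \<in> I \<Longrightarrow> x \<in> F i \<Longrightarrow> \<exists>j\<in>J. x \<in> G j"
  shows "hilbert_sum I F \<subseteq> hilbert_sum J G"
proof (rule hilbert_sum_least [OF closed_csubspace_hilbert_sum], rule subsetI)
  fix i x
  assume "i \<in> I" "x \<in> F i"
  then obtain j where "j \<in> J" "x \<in> G j"
    using assms by blast
  then show "x \<in> hilbert_sum J G"
    using hilbert_sum_upper [of j J G] by blast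
qed

text \<open>The vectors orthogonal to a given \<open>x\<close> form a closed subspace, so
  orthogonality to all summands passes to their sum.\<close>

lemma ocompl_hilbert_sum:
  "ocompl (hilbert_sum I F) = {x. \<forall>i\<in>I. \<forall>y\<in>F i. cinner x y = 0}"
proof (intro set_eqI iffI CollectI)
  fix x
  assume "x \<in> {x. \<forall>i\<in>I. \<forall>y\<in>F i. cinner x y = 0}"
  then have "hilbert_sum I F \<subseteq> ocompl {x}"
    by (intro hilbert_sum_least closed_csubspace_ocompl)
      (unfold ocompl_def, blast intro: cinner_eq_0_commute)
  then show "x \<in> ocompl (hilbert_sum I F)"
    unfolding ocompl_def by (blast intro: cinner_eq_0_commute)
next
  fix x
  assume "x \<in> ocompl (hilbert_sum I F)"
  then show "\<forall>i\<in>I. \<forall>y\<in>F i. cinner x y = 0"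
    using hilbert_sum_upper [of _ I F] unfolding ocompl_def by blast
qed

section \<open>Bounded operators and adjoints\<close>

abbreviation bounded_op :: "('a::complex_hilbert_space \<Rightarrow> 'a) \<Rightarrow> bool"
  where "bounded_op \<equiv> bounded_op_on UNIV"

lemma bounded_op_add: "bounded_op T \<Longrightarrow> T (x + y) = T x + T y"
  and bounded_op_scaleC: "bounded_op T \<Longrightarrow> T (scaleC c x) = scaleC c (T x)"
  by (simp_all add: bounded_op_on_def)

lemma bounded_op_0: "bounded_op T \<Longrightarrow> T 0 = 0"
  using bounded_op_add [of T 0 0] by simp

lemma bounded_op_bounded_linear:
  assumes "bounded_op T"
  shows "bounded_linear T"
proof -
  obtain B where "\<And>x. norm (T x) \<le> B * norm x"
    using assms by (auto simp: bounded_op_on_def)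
  then show ?thesis
    by (intro bounded_linear_intro [where K = B])
      (auto simp: bounded_op_add [OF assms] bounded_op_scaleC [OF assms] scaleR_scaleC mult.commute)
qed

lemma bounded_op_diff: "bounded_op T \<Longrightarrow> T (x - y) = T x - T y"
  using bounded_op_bounded_linear by (metis bounded_linear.linear linear_diff)

lemma bounded_op_sum: "bounded_op T \<Longrightarrow> T (\<Sum>s\<in>S. f s) = (\<Sum>s\<in>S. T (f s))"
  using bounded_op_bounded_linear by (metis bounded_linear.linear linear_sum)

lemma bounded_op_id: "bounded_op id"
  by (auto simp: bounded_op_on_def intro: exI [of _ 1])

lemma bounded_op_comp:
  assumes "bounded_op S" "bounded_op T"
  shows "bounded_op (S \<circ> T)"
proof -
  obtain B where "\<And>x. norm ((S \<circ> T) x) \<le> norm x * B"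
    using bounded_linear.bounded [OF bounded_linear_compose] bounded_op_bounded_linear assms
    by (metis comp_apply)
  then show ?thesis
    using assms by (auto simp: bounded_op_on_def mult.commute)
qed

lemma closed_csubspace_vimage:
  assumes "bounded_op T" "closed_csubspace M"
  shows "closed_csubspace (T -` M)"
proof -
  have "closed (T -` M)"
    using assms bounded_op_bounded_linear linear_continuous_on
    by (metis closed_csubspaceD(2) closed_vimage)
  moreover have "csubspace (T -` M)"
    using closed_csubspaceD(1) [OF assms(2)]
    by (intro csubspaceI)
      (auto simp: bounded_op_0 bounded_op_add bounded_op_scaleC assms(1) csubspace_0 csubspace_add
        csubspace_scaleC)
  ultimately show ?thesis
    by (simp add: closed_csubspace_def)
qed

text \<open>Preimages of closed subspaces under bounded operators are closed subspaces. Invariance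
  claims about Hilbert sums are reduced to single summands through this rule.\<close>

lemma bounded_op_image_hilbert_sum:
  assumes "bounded_op T" "closed_csubspace M" "\<And>i x. i \<in> I \<Longrightarrow> x \<in> F i \<Longrightarrow> T x \<in> M"
    and "x \<in> hilbert_sum I F"
  shows "T x \<in> M"
proof -
  have "hilbert_sum I F \<subseteq> T -` M"
    by (intro hilbert_sum_least closed_csubspace_vimage assms) (use assms(3) in auto)
  with assms(4) show ?thesis
    by blast
qed

lemma riesz_representation:
  fixes f :: "'a::complex_hilbert_space \<Rightarrow> complex"
  assumes add: "\<And>x y. f (x + y) = f x + f y"
    and scale: "\<And>c x. f (scaleC c x) = c * f x"
    and bound: "\<And>x. cmod (f x) \<le> B * norm x"
  obtains z where "\<And>y. f y = cinner y z"
proof -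
  have lin: "bounded_linear f"
    by (rule bounded_linear_intro [where K = B])
      (auto simp: add scale bound scaleR_scaleC [where 'a = 'a] scaleR_conv_of_real mult.commute)
  define M where "M = {x. f x = 0}"
  have "csubspace M"
    using scale [of 0 0] by (intro csubspaceI) (auto simp: M_def add scale)
  moreover have "closed M"
    unfolding M_def by (intro closed_Collect_eq continuous_on_const linear_continuous_on lin)
  ultimately have M: "closed_csubspace M"
    by (simp add: closed_csubspace_def)
  show ?thesis
  proof (cases "\<forall>x. f x = 0")
    case True
    then show ?thesis
      using that [of 0] by simp
  next
    case False
    then obtain x where "f x \<noteq> 0"
      by blast
    obtain m u where "m \<in> M" and u: "u \<in> ocompl M" and "x = m + u"
      using orthogonal_decomposition [OF M] .
    then have fu: "f u \<noteq> 0"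
      using \<open>f x \<noteq> 0\<close> add by (simp add: M_def)
    have "u \<noteq> 0"
      using fu linear_0 [OF bounded_linear.linear [OF lin]] by auto
    \<comment> \<open>Normalized so that \<open>cinner u z = f u\<close>; the conjugate compensates
      for the conjugate-linear second argument.\<close>
    define z where "z = scaleC (cnj (f u / complex_of_real ((norm u)\<^sup>2))) u"
    have "f y = cinner y z" for y
    proof -
      define w where "w = y - scaleC (f y / f u) u"
      have "f w = 0"
        using fu add [of w "scaleC (f y / f u) u"] by (simp add: w_def scale)
      then have "cinner u w = 0"
        using u by (auto simp: M_def ocompl_def)
      then have "cinner w u = 0"
        by (rule cinner_eq_0_commute)
      then have "cinner y u = f y / f u * complex_of_real ((norm u)\<^sup>2)"
        by (simp add: w_def cinner_diff_left cinner_scaleC_left cinner_self)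
      then show ?thesis
        using fu \<open>u \<noteq> 0\<close> by (simp add: z_def cinner_scaleC_right)
    qed
    then show ?thesis
      by (rule that)
  qed
qed

text \<open>The definite description in \<open>adj_on\<close> has a usable value only once
  uniqueness is known: the difference of two solutions lies in \<open>M\<close> and is orthogonal to
  itself.\<close>

lemma adj_on_eqI:
  fixes M :: "'a::complex_hilbert_space set"
  assumes "closed_csubspace M" "z \<in> M" "\<And>y. y \<in> M \<Longrightarrow> cinner z y = cinner x (T y)"
  shows "adj_on M T x = z"
  unfolding adj_on_def
proof (rule the_equality)
  fix w
  assume w: "w \<in> M \<and> (\<forall>y\<in>M. cinner w y = cinner x (T y))"
  have "w - z \<in> M"
    using w assms by (simp add: csubspace_diff closed_csubspaceD)
  then have "cinner (w - z) (w - z) = 0"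
    using w assms(3) by (simp add: cinner_diff_left)
  then show "w = z"
    by simp
qed (use assms in auto)

lemma cinner_adj_left:
  assumes T: "bounded_op T"
  shows "cinner (adj T x) y = cinner x (T y)"
proof -
  obtain B where B: "\<And>y. norm (T y) \<le> B * norm y"
    using T by (auto simp: bounded_op_on_def)
  have "cmod (cinner (T y) x) \<le> (B * norm x) * norm y" for y
    using norm_cinner_le [of "T y" x] mult_right_mono [OF B, of "norm x" y]
    by (simp add: mult_ac)
  \<comment> \<open>The functional sending \<open>y\<close> to \<open>cinner x (T y)\<close> is
    conjugate-linear, so the Riesz theorem is applied to its conjugate.\<close>
  then obtain z where z: "\<And>y. cinner (T y) x = cinner y z"
    using riesz_representation [of "\<lambda>y. cinner (T y) x" "B * norm x"]
    by (simp add: bounded_op_add [OF T] bounded_op_scaleC [OF T] cinner_add_left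
        cinner_scaleC_left) blast
  have *: "cinner z y = cinner x (T y)" for y
    using z [of y] cinner_commute [of x "T y"] cinner_commute [of z y] by simp
  then have "adj T x = z"
    by (intro adj_on_eqI closed_csubspace_UNIV) auto
  with * show ?thesis
    by simp
qed

lemma cinner_adj_right: "bounded_op T \<Longrightarrow> cinner x (adj T y) = cinner (T x) y"
  by (metis cinner_adj_left cinner_commute)

lemma bounded_op_adj:
  assumes T: "bounded_op T"
  shows "bounded_op (adj T)"
proof -
  obtain B where B: "\<And>y. norm (T y) \<le> B * norm y"
    using T by (auto simp: bounded_op_on_def)
  have "norm (adj T x) \<le> B * norm x" for x
  proof (cases "adj T x = 0")
    case True
    have "0 \<le> B * norm x"
      using B [of x] norm_ge_zero order_trans by blast
    with True show ?thesis
      by simp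
  next
    case False
    have "(norm (adj T x))\<^sup>2 = cmod (cinner (adj T x) (adj T x))"
      by (simp add: cinner_self norm_power)
    also have "\<dots> = cmod (cinner x (T (adj T x)))"
      by (simp add: cinner_adj_left T)
    also have "\<dots> \<le> norm x * (B * norm (adj T x))"
      using norm_cinner_le B by (meson mult_left_mono norm_ge_zero order_trans)
    finally show ?thesis
      using False by (simp add: power2_eq_square mult_ac)
  qed
  moreover have "adj T (x + y) = adj T x + adj T y" for x y
    by (rule cinner_extensionality) (simp add: cinner_adj_left T cinner_add_left)
  moreover have "adj T (scaleC c x) = scaleC c (adj T x)" for c x
    by (rule cinner_extensionality) (simp add: cinner_adj_left T cinner_scaleC_left)
  ultimately show ?thesis
    by (auto simp: bounded_op_on_def)
qed

lemma reducing_for_ocompl: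
  assumes "bounded_op T" "reducing_for M T"
  shows "reducing_for (ocompl M) T"
  using assms
  unfolding reducing_for_def ocompl_def by (simp add: cinner_adj_left)
    (simp flip: cinner_adj_right)

lemma reducing_for_Int: "reducing_for M T \<Longrightarrow> reducing_for N T \<Longrightarrow> reducing_for (M \<inter> N) T"
  by (auto simp: reducing_for_def)

lemma reducing_for_INT:
  "(\<And>i. i \<in> I \<Longrightarrow> reducing_for (F i) T) \<Longrightarrow> reducing_for (\<Inter>i\<in>I. F i) T"
  by (auto simp: reducing_for_def)

text \<open>Invariance under \<open>adj T\<close> keeps \<open>adj T x\<close> inside
  \<open>M\<close>, where it solves the defining equation; thus the adjoint of the restriction is
  the restriction of the adjoint.\<close>

lemma adj_on_reducing:
  assumes "closed_csubspace M" "bounded_op T" "reducing_for M T" "x \<in> M"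
  shows "adj_on M T x = adj T x"
  using assms by (intro adj_on_eqI) (auto simp: reducing_for_def cinner_adj_left)

text \<open>The scalar is hidden because words produce long products of matrix entries that no
  subspace can detect. Being nonzero makes the relation symmetric.\<close>

definition scalar_commute :: "('a::complex_hilbert_space \<Rightarrow> 'a) \<Rightarrow> ('a \<Rightarrow> 'a) \<Rightarrow> bool"
  where "scalar_commute S T \<longleftrightarrow> (\<exists>c. c \<noteq> 0 \<and> (\<forall>x. S (T x) = scaleC c (T (S x))))"

lemma scalar_commute_id: "scalar_commute S id"
  by (auto simp: scalar_commute_def scaleC_one intro: exI [of _ 1])

lemma scalar_commute_sym:
  assumes "scalar_commute S T"
  shows "scalar_commute T S"
proof -
  obtain c where "c \<noteq> 0" "\<And>x. S (T x) = scaleC c (T (S x))"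
    using assms by (auto simp: scalar_commute_def)
  then show ?thesis
    unfolding scalar_commute_def
    by (intro exI [of _ "inverse c"]) (simp add: scaleC_scaleC scaleC_one)
qed

lemma scalar_commute_comp:
  assumes "bounded_op T" "scalar_commute S T" "scalar_commute S R"
  shows "scalar_commute S (T \<circ> R)"
proof -
  obtain c d where "c \<noteq> 0" "\<And>x. S (T x) = scaleC c (T (S x))"
    "d \<noteq> 0" "\<And>x. S (R x) = scaleC d (R (S x))"
    using assms by (auto simp: scalar_commute_def)
  then show ?thesis
    unfolding scalar_commute_def
    by (intro exI [of _ "c * d"]) (simp add: scaleC_scaleC bounded_op_scaleC assms(1))
qed

section \<open>A single row isometry\<close>

lemma word_op_Nil [simp]: "word_op V [] = id"
  and word_op_Cons [simp]: "word_op V (s # \<alpha>) = V s \<circ> word_op V \<alpha>"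
  by (simp_all add: word_op_def)

lemma word_op_append: "word_op V (\<alpha> @ \<beta>) = word_op V \<alpha> \<circ> word_op V \<beta>"
  by (induction \<alpha>) (auto simp: fun_eq_iff)

locale row_isometry =
  fixes n :: nat and V :: "nat \<Rightarrow> 'a::complex_hilbert_space \<Rightarrow> 'a"
  assumes row_isometry: "row_isometry_on UNIV n V"
begin

lemma bounded_op_V: "s \<in> {1..n} \<Longrightarrow> bounded_op (V s)"
  using row_isometry by (auto simp: row_isometry_on_def)

lemma adj_V: "s \<in> {1..n} \<Longrightarrow> t \<in> {1..n} \<Longrightarrow> adj (V s) (V t x) = (if s = t then x else 0)"
  using row_isometry by (auto simp: row_isometry_on_def)

lemma bounded_op_word_op: "\<alpha> \<in> words n \<Longrightarrow> bounded_op (word_op V \<alpha>)"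
  by (induction \<alpha>) (auto intro!: bounded_op_id bounded_op_comp bounded_op_V)

lemma cinner_V_V:
  assumes "s \<in> {1..n}" "t \<in> {1..n}"
  shows "cinner (V s x) (V t y) = (if s = t then cinner x y else 0)"
proof -
  have "cinner (V s x) (V t y) = cinner (adj (V t) (V s x)) y"
    using assms by (simp add: cinner_adj_left bounded_op_V)
  then show ?thesis
    using assms by (auto simp: adj_V)
qed

lemma cinner_word_op: "\<alpha> \<in> words n \<Longrightarrow> cinner (word_op V \<alpha> x) (word_op V \<alpha> y) = cinner x y"
  by (induction \<alpha>) (auto simp: cinner_V_V)

text \<open>Equal lengths prevent one word from being a proper prefix of the other. The common
  prefix is isometric and drops out; at the letter where the words split, the ranges are
  orthogonal.\<close>

lemma word_op_orthogonal_same_length: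
  assumes "\<alpha> \<in> words n" "\<beta> \<in> words n" "length \<alpha> = length \<beta>" "\<alpha> \<noteq> \<beta>"
  shows "cinner (word_op V \<alpha> x) (word_op V \<beta> y) = 0"
  using assms(3,1,2,4)
  by (induction \<alpha> \<beta> rule: list_induct2) (auto simp: cinner_V_V)

lemma common_ker_iff: "x \<in> common_ker n V \<longleftrightarrow> (\<forall>s\<in>{1..n}. adj (V s) x = 0)"
  by (simp add: common_ker_def)

lemma common_ker_orthogonal:
  assumes "x \<in> common_ker n V" "\<alpha> \<in> words n" "\<alpha> \<noteq> []"
  shows "cinner x (word_op V \<alpha> y) = 0"
proof -
  obtain s \<beta> where "\<alpha> = s # \<beta>" "s \<in> {1..n}"
    using assms(2,3) by (cases \<alpha>) auto
  then show ?thesis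
    using assms(1) by (simp add: cinner_adj_left [symmetric] bounded_op_V common_ker_iff)
qed

text \<open>Lengths may differ here. After cancelling the common prefix, either the next letters
  differ or one word is used up, and a kernel vector meets the range of a nonempty word.\<close>

lemma word_op_common_ker_orthogonal:
  assumes "\<alpha> \<in> words n" "\<beta> \<in> words n" "\<alpha> \<noteq> \<beta>" "x \<in> common_ker n V" "y \<in> common_ker n V"
  shows "cinner (word_op V \<alpha> x) (word_op V \<beta> y) = 0"
  using assms(1-3)
proof (induction \<alpha> arbitrary: \<beta>)
  case Nil
  then show ?case
    using common_ker_orthogonal assms(4) by simp
next
  case (Cons s \<alpha>)
  show ?case
  proof (cases \<beta>)
    case Nil
    have "cinner y (word_op V (s # \<alpha>) x) = 0"
      using assms(5) by (rule common_ker_orthogonal) (use Cons.hyps in auto)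
    then show ?thesis
      unfolding Nil by (simp add: cinner_eq_0_commute)
  next
    case (Cons t \<gamma>)
    then show ?thesis
      using Cons.prems Cons.IH Cons.hyps by (auto simp: cinner_V_V)
  qed
qed

lemma closed_csubspace_common_ker: "closed_csubspace (common_ker n V)"
proof -
  have "common_ker n V = (\<Inter>s\<in>{1..n}. adj (V s) -` {0})"
    by (auto simp: common_ker_def)
  moreover have "closed_csubspace {0::'a}"
    by (auto simp: closed_csubspace_def intro!: csubspaceI)
  ultimately show ?thesis
    by (auto intro!: closed_csubspace_INT closed_csubspace_vimage bounded_op_adj bounded_op_V)
qed

text \<open>The orthogonal projection of \<open>x\<close> onto \<open>common_ker n V\<close>, the
  subtracted sum being its projection onto the span of the ranges.\<close>

definition defect :: "'a \<Rightarrow> 'a"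
  where "defect x = x - (\<Sum>s\<in>{1..n}. V s (adj (V s) x))"

lemma defect_in_common_ker: "defect x \<in> common_ker n V"
  unfolding common_ker_iff
proof
  fix t
  assume t: "t \<in> {1..n}"
  have "adj (V t) (defect x) = adj (V t) x - (\<Sum>s\<in>{1..n}. adj (V t) (V s (adj (V s) x)))"
    using bounded_op_adj [OF bounded_op_V [OF t]]
    by (simp only: defect_def bounded_op_diff bounded_op_sum)
  also have "(\<Sum>s\<in>{1..n}. adj (V t) (V s (adj (V s) x))) =
      (\<Sum>s\<in>{1..n}. if t = s then adj (V s) x else 0)"
    using t by (intro sum.cong) (auto simp: adj_V)
  finally show "adj (V t) (defect x) = 0"
    using t by (simp add: sum.delta)
qed

lemma defect_in_reducing:
  assumes "csubspace M" "\<And>s. s \<in> {1..n} \<Longrightarrow> reducing_for M (V s)" "x \<in> M"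
  shows "defect x \<in> M"
  unfolding defect_def using assms
  by (intro csubspace_diff complex_vector.subspace_sum) (auto simp: reducing_for_def)

lemma defect_eq_0_iff: "defect x = 0 \<longleftrightarrow> (\<Sum>s\<in>{1..n}. V s (adj (V s) x)) = x"
  by (auto simp: defect_def)

text \<open>The ranges are orthogonal to the defect, so \<open>cinner x (defect x)\<close> is the
  squared norm of \<open>defect x\<close>.\<close>

lemma defect_eq_0:
  assumes "cinner x (defect x) = 0"
  shows "defect x = 0"
proof -
  have "cinner (V s (adj (V s) x)) (defect x) = 0" if "s \<in> {1..n}" for s
    using that defect_in_common_ker [of x]
    by (simp add: cinner_adj_right [symmetric] bounded_op_V common_ker_iff)
  then have "cinner (defect x) (defect x) = 0"
    using assms by (subst defect_def) (simp add: cinner_diff_left cinner_sum_left)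
  then show ?thesis
    by simp
qed

section \<open>The Wold decomposition of one row\<close>

lemma closed_csubspace_shift_part: "closed_csubspace (shift_part n V)"
  by (simp add: shift_part_def closed_csubspace_hilbert_sum)

lemma closed_csubspace_cuntz_part: "closed_csubspace (cuntz_part n V)"
  unfolding cuntz_part_def by (intro closed_csubspace_INT closed_csubspace_hilbert_sum)

lemma common_ker_subset_shift_part: "common_ker n V \<subseteq> shift_part n V"
  using hilbert_sum_upper [of "[]" "words n" "\<lambda>\<alpha>. word_op V \<alpha> ` common_ker n V"]
  by (simp add: shift_part_def)

text \<open>\<open>V s\<close> prepends a letter to a word. \<open>adj (V s)\<close> removes a
  leading \<open>s\<close>, and kills a word with another leading letter as well as the kernel
  vectors at the empty word.\<close>

lemma reducing_for_shift_part:
  assumes s: "s \<in> {1..n}"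
  shows "reducing_for (shift_part n V) (V s)"
proof -
  have in_shift: "word_op V \<alpha> y \<in> shift_part n V" if "\<alpha> \<in> words n" "y \<in> common_ker n V" for \<alpha> y
    using hilbert_sum_upper [of \<alpha> "words n" "\<lambda>\<alpha>. word_op V \<alpha> ` common_ker n V"] that
    by (auto simp: shift_part_def)
  have "V s x \<in> shift_part n V" if "x \<in> shift_part n V" for x
    using bounded_op_V [OF s] closed_csubspace_shift_part _ that [unfolded shift_part_def]
  proof (rule bounded_op_image_hilbert_sum)
    fix \<alpha> x
    assume "\<alpha> \<in> words n" "x \<in> word_op V \<alpha> ` common_ker n V"
    then show "V s x \<in> shift_part n V"
      using in_shift [of "s # \<alpha>"] s by auto
  qed
  moreover have "adj (V s) x \<in> shift_part n V" if "x \<in> shift_part n V" for x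
    using bounded_op_adj [OF bounded_op_V [OF s]] closed_csubspace_shift_part _
      that [unfolded shift_part_def]
  proof (rule bounded_op_image_hilbert_sum)
    fix \<alpha> x
    assume \<alpha>: "\<alpha> \<in> words n" and "x \<in> word_op V \<alpha> ` common_ker n V"
    then obtain y where y: "y \<in> common_ker n V" and x: "x = word_op V \<alpha> y"
      by blast
    have 0: "0 \<in> shift_part n V"
      by (simp add: csubspace_0 closed_csubspaceD closed_csubspace_shift_part)
    show "adj (V s) x \<in> shift_part n V"
    proof (cases \<alpha>)
      case Nil
      then show ?thesis
        using x y s 0 by (simp add: common_ker_iff)
    next
      case (Cons t \<beta>)
      then show ?thesis
        using x y s \<alpha> 0 in_shift [of \<beta> y] by (simp add: adj_V)
    qed
  qed
  ultimately show ?thesis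
    by (auto simp: reducing_for_def)
qed

lemma ocompl_shift_part:
  "ocompl (shift_part n V) =
    {x. \<forall>\<alpha>\<in>words n. \<forall>y\<in>common_ker n V. cinner x (word_op V \<alpha> y) = 0}"
  by (auto simp: shift_part_def ocompl_hilbert_sum)

text \<open>Adjoints strip the letters of the word and move them onto \<open>x\<close>, which stays
  in \<open>M\<close>. At the empty word, vanishing defect writes \<open>x\<close> as a sum of range
  vectors, all orthogonal to the kernel.\<close>

lemma in_ocompl_shift_partI:
  assumes inv: "\<And>s x. s \<in> {1..n} \<Longrightarrow> x \<in> M \<Longrightarrow> adj (V s) x \<in> M"
    and defect: "\<And>x. x \<in> M \<Longrightarrow> defect x = 0"
    and "x \<in> M"
  shows "x \<in> ocompl (shift_part n V)"
proof -
  have "cinner x (word_op V \<alpha> y) = 0" if "\<alpha> \<in> words n" "y \<in> common_ker n V" for \<alpha> y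
    using that(1) \<open>x \<in> M\<close>
  proof (induction \<alpha> arbitrary: x)
    case Nil
    then have "x = (\<Sum>s\<in>{1..n}. V s (adj (V s) x))"
      using defect by (simp add: defect_eq_0_iff)
    moreover have "cinner (V s (adj (V s) x)) y = 0" if "s \<in> {1..n}" for s
      using that \<open>y \<in> common_ker n V\<close>
      by (simp add: cinner_adj_right [symmetric] bounded_op_V common_ker_iff)
    ultimately have "cinner x y = 0"
      by (metis (no_types, lifting) cinner_sum_left sum.neutral)
    then show ?case
      by simp
  next
    case (Cons s \<alpha>)
    then show ?case
      using inv by (simp add: cinner_adj_left [symmetric] bounded_op_V)
  qed
  then show ?thesis
    by (simp add: ocompl_shift_part)
qed

text \<open>The expansion of \<open>x\<close> as the sum of \<open>V s (adj (V s) x)\<close> can be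
  repeated \<open>p\<close> times, because each \<open>adj (V s) x\<close> is again a vector of
  \<open>M\<close> without defect.\<close>

lemma in_hilbert_sum_word_op:
  assumes red: "\<And>s. s \<in> {1..n} \<Longrightarrow> reducing_for M (V s)"
    and defect: "\<And>x. x \<in> M \<Longrightarrow> defect x = 0"
    and "x \<in> M"
  shows "x \<in> hilbert_sum {\<alpha> \<in> words n. length \<alpha> = p} (\<lambda>\<alpha>. word_op V \<alpha> ` M)"
  using \<open>x \<in> M\<close>
proof (induction p arbitrary: x)
  case 0
  then show ?case
    using hilbert_sum_upper [of "[]" "{\<alpha> \<in> words n. length \<alpha> = 0}" "\<lambda>\<alpha>. word_op V \<alpha> ` M"]
    by auto
next
  case (Suc p)
  define H where "H = hilbert_sum {\<alpha> \<in> words n. length \<alpha> = Suc p} (\<lambda>\<alpha>. word_op V \<alpha> ` M)"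
  have H: "closed_csubspace H"
    by (simp add: H_def closed_csubspace_hilbert_sum)
  have x: "(\<Sum>s\<in>{1..n}. V s (adj (V s) x)) = x"
    using defect [OF Suc.prems] defect_eq_0_iff by blast
  have "V s (adj (V s) x) \<in> H" if s: "s \<in> {1..n}" for s
  proof -
    have "adj (V s) x \<in> M"
      using red [OF s] Suc.prems by (simp add: reducing_for_def)
    from Suc.IH [OF this] show ?thesis
      using bounded_op_V [OF s] H
    proof (rule bounded_op_image_hilbert_sum [rotated 3])
      fix \<alpha> y
      assume "\<alpha> \<in> {\<alpha> \<in> words n. length \<alpha> = p}" "y \<in> word_op V \<alpha> ` M"
      then show "V s y \<in> H"
        using s hilbert_sum_upper [of "s # \<alpha>" "{\<alpha> \<in> words n. length \<alpha> = Suc p}"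
            "\<lambda>\<alpha>. word_op V \<alpha> ` M"]
        by (auto simp: H_def)
    qed
  qed
  then have "(\<Sum>s\<in>{1..n}. V s (adj (V s) x)) \<in> H"
    using H by (intro complex_vector.subspace_sum) (auto simp: closed_csubspaceD)
  then show ?case
    unfolding x H_def .
qed

lemma cuntz_part_eq: "cuntz_part n V = ocompl (shift_part n V)"
proof (intro equalityI subsetI)
  fix x
  assume x: "x \<in> cuntz_part n V"
  have "cinner x (word_op V \<alpha> y) = 0" if \<alpha>: "\<alpha> \<in> words n" and y: "y \<in> common_ker n V" for \<alpha> y
  proof -
    \<comment> \<open>One letter more than \<open>\<alpha>\<close> suffices: once
      \<open>\<alpha>\<close> is cancelled, the remaining nonempty word has range orthogonal to the
      kernel vector \<open>y\<close>.\<close>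
    have "cinner (word_op V \<alpha> y) (word_op V \<beta> z) = 0"
      if \<beta>: "\<beta> \<in> words n" "length \<beta> = Suc (length \<alpha>)" for \<beta> z
      using \<alpha> \<beta>
    proof (induction \<alpha> arbitrary: \<beta>)
      case Nil
      then show ?case
        using common_ker_orthogonal [OF y] by fastforce
    next
      case (Cons s \<alpha>)
      then show ?case
        by (cases \<beta>) (auto simp: cinner_V_V)
    qed
    then have "word_op V \<alpha> y \<in>
        ocompl (hilbert_sum {\<beta> \<in> words n. length \<beta> = Suc (length \<alpha>)} (\<lambda>\<beta>. word_op V \<beta> ` UNIV))"
      by (auto simp: ocompl_hilbert_sum)
    moreover have "x \<in> hilbert_sum {\<beta> \<in> words n. length \<beta> = Suc (length \<alpha>)} (\<lambda>\<beta>. word_op V \<beta> ` UNIV)"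
      using x by (simp add: cuntz_part_def)
    ultimately show ?thesis
      by (simp add: ocompl_def cinner_eq_0_commute)
  qed
  then show "x \<in> ocompl (shift_part n V)"
    by (simp add: ocompl_shift_part)
next
  define C where "C = ocompl (shift_part n V)"
  fix x
  assume "x \<in> ocompl (shift_part n V)"
  then have "x \<in> C"
    by (simp add: C_def)
  have red: "reducing_for C (V s)" if "s \<in> {1..n}" for s
    unfolding C_def using that by (intro reducing_for_ocompl bounded_op_V reducing_for_shift_part)
  \<comment> \<open>The defect lies in the shift part, as the summand of the empty word, whereas
    \<open>v\<close> is orthogonal to that part.\<close>
  have "defect v = 0" if "v \<in> C" for v
  proof (rule defect_eq_0)
    have "defect v \<in> shift_part n V"
      using defect_in_common_ker common_ker_subset_shift_part by blast
    then show "cinner v (defect v) = 0"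
      using that by (simp add: C_def ocompl_def)
  qed
  from in_hilbert_sum_word_op [OF red this \<open>x \<in> C\<close>]
  have "x \<in> hilbert_sum {\<alpha> \<in> words n. length \<alpha> = p} (\<lambda>\<alpha>. word_op V \<alpha> ` UNIV)" for p
    using hilbert_sum_mono [of "{\<alpha> \<in> words n. length \<alpha> = p}" "\<lambda>\<alpha>. word_op V \<alpha> ` C"
        "{\<alpha> \<in> words n. length \<alpha> = p}" "\<lambda>\<alpha>. word_op V \<alpha> ` UNIV"] by blast
  then show "x \<in> cuntz_part n V"
    by (simp add: cuntz_part_def)
qed

lemma cuntz_part_sum:
  assumes "x \<in> cuntz_part n V"
  shows "(\<Sum>s\<in>{1..n}. V s (adj (V s) x)) = x"
proof -
  have "defect x \<in> shift_part n V"
    using defect_in_common_ker common_ker_subset_shift_part by blast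
  then have "cinner x (defect x) = 0"
    using assms by (simp add: cuntz_part_eq ocompl_def)
  then show ?thesis
    using defect_eq_0 defect_eq_0_iff by blast
qed

lemma reducing_subspace_of_shift_part:
  assumes M: "closed_csubspace M" and red: "\<And>s. s \<in> {1..n} \<Longrightarrow> reducing_for M (V s)"
    and shift: "M \<subseteq> shift_part n V"
  shows "M \<subseteq> hilbert_sum (words n) (\<lambda>\<alpha>. word_op V \<alpha> ` (M \<inter> common_ker n V))"
proof
  define H where "H = hilbert_sum (words n) (\<lambda>\<alpha>. word_op V \<alpha> ` (M \<inter> common_ker n V))"
  have H: "closed_csubspace H"
    by (simp add: H_def closed_csubspace_hilbert_sum)
  have word_M: "word_op V \<alpha> y \<in> M" if "\<alpha> \<in> words n" "y \<in> M" for \<alpha> y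
    using that by (induction \<alpha>) (use red in \<open>auto simp: reducing_for_def\<close>)
  have HM: "H \<subseteq> M"
    unfolding H_def by (intro hilbert_sum_least M) (auto intro: word_M)
  have VH: "V s h \<in> H" if s: "s \<in> {1..n}" and h: "h \<in> H" for s h
    using bounded_op_V [OF s] H _ h [unfolded H_def]
  proof (rule bounded_op_image_hilbert_sum)
    fix \<alpha> y
    assume "\<alpha> \<in> words n" "y \<in> word_op V \<alpha> ` (M \<inter> common_ker n V)"
    then show "V s y \<in> H"
      using s hilbert_sum_upper [of "s # \<alpha>" "words n"
          "\<lambda>\<alpha>. word_op V \<alpha> ` (M \<inter> common_ker n V)"]
      by (auto simp: H_def)
  qed
  fix x
  assume "x \<in> M"
  obtain h u where h: "h \<in> H" and u: "u \<in> ocompl H" and x: "x = h + u"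
    using orthogonal_decomposition [OF H, of x] by blast
  have "u \<in> M"
    using csubspace_diff [OF closed_csubspaceD(1) [OF M] \<open>x \<in> M\<close>, of h] h HM x by auto
  \<comment> \<open>What \<open>H\<close> misses in \<open>M\<close> is invariant under the adjoints
    because \<open>H\<close> is invariant under each \<open>V s\<close>. Its vectors have no defect,
    since their defects lie in \<open>M \<inter> common_ker n V\<close>, which \<open>H\<close>
    contains. So \<open>u\<close> is orthogonal to the shift part in which it lies.\<close>
  have "u \<in> ocompl (shift_part n V)"
  proof (rule in_ocompl_shift_partI [of "M \<inter> ocompl H"])
    fix s v
    assume "s \<in> {1..n}" "v \<in> M \<inter> ocompl H"
    then show "adj (V s) v \<in> M \<inter> ocompl H"
      using red VH by (auto simp: reducing_for_def ocompl_def cinner_adj_left bounded_op_V)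
  next
    fix v
    assume v: "v \<in> M \<inter> ocompl H"
    have "defect v \<in> M \<inter> common_ker n V"
      using defect_in_common_ker defect_in_reducing closed_csubspaceD(1) [OF M] red v by blast
    then have "defect v \<in> H"
      using hilbert_sum_upper [of "[]" "words n" "\<lambda>\<alpha>. word_op V \<alpha> ` (M \<inter> common_ker n V)"]
      by (auto simp: H_def)
    then show "defect v = 0"
      using v by (intro defect_eq_0) (simp add: ocompl_def)
  qed (use u \<open>u \<in> M\<close> in simp)
  then have "u = 0"
    using \<open>u \<in> M\<close> shift by (auto intro: ocompl_self_eq_0)
  then show "x \<in> hilbert_sum (words n) (\<lambda>\<alpha>. word_op V \<alpha> ` (M \<inter> common_ker n V))"
    using h x by (simp add: H_def)
qed

lemma scalar_commute_word_op:
  assumes "\<And>s. s \<in> {1..n} \<Longrightarrow> scalar_commute T (V s)" "\<alpha> \<in> words n"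
  shows "scalar_commute T (word_op V \<alpha>)"
  using assms(2)
proof (induction \<alpha>)
  case Nil
  show ?case
    unfolding word_op_Nil by (rule scalar_commute_id)
next
  case (Cons s \<alpha>)
  then show ?case
    unfolding word_op_Cons by (intro scalar_commute_comp bounded_op_V assms(1)) auto
qed

text \<open>A criterion meant for an operator of a different row and for its adjoint: it passes
  through each word up to a scalar and acts on the kernel vector behind it.\<close>

lemma shift_part_invariant:
  assumes T: "bounded_op T"
    and comm: "\<And>s. s \<in> {1..n} \<Longrightarrow> scalar_commute T (V s)"
    and ker: "\<And>y. y \<in> common_ker n V \<Longrightarrow> T y \<in> common_ker n V"
    and x: "x \<in> shift_part n V"
  shows "T x \<in> shift_part n V"
  using T closed_csubspace_shift_part _ x [unfolded shift_part_def]
proof (rule bounded_op_image_hilbert_sum)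
  fix \<alpha> z
  assume \<alpha>: "\<alpha> \<in> words n" and "z \<in> word_op V \<alpha> ` common_ker n V"
  then obtain y where y: "y \<in> common_ker n V" and z: "z = word_op V \<alpha> y"
    by blast
  obtain c where "T z = scaleC c (word_op V \<alpha> (T y))"
    using scalar_commute_word_op [OF comm \<alpha>] by (auto simp: scalar_commute_def z)
  moreover have "word_op V \<alpha> (T y) \<in> shift_part n V"
    using hilbert_sum_upper [of \<alpha> "words n" "\<lambda>\<alpha>. word_op V \<alpha> ` common_ker n V"] \<alpha> ker [OF y]
    by (auto simp: shift_part_def)
  ultimately show "T z \<in> shift_part n V"
    using csubspace_scaleC [OF closed_csubspaceD(1) [OF closed_csubspace_shift_part]] by simp
qed

end

section \<open>Doubly commuting row isometries\<close>

lemma multi_op_Nil [simp]: "multi_op V [] \<alpha> = id"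
  and multi_op_Cons [simp]: "multi_op V (i # il) \<alpha> = word_op (V i) (\<alpha> i) \<circ> multi_op V il \<alpha>"
  by (simp_all add: multi_op_def)

lemma multi_op_cong:
  assumes "\<And>i. i \<in> set il \<Longrightarrow> \<alpha> i = \<beta> i"
  shows "multi_op V il \<alpha> = multi_op V il \<beta>"
  using assms by (induction il) auto

lemma multi_op_fun_upd [simp]: "i \<notin> set il \<Longrightarrow> multi_op V il (\<alpha>(i := w)) = multi_op V il \<alpha>"
  by (rule multi_op_cong) auto

lemma multi_op_empty_words:
  assumes "\<And>i. i \<in> set il \<Longrightarrow> \<alpha> i = []"
  shows "multi_op V il \<alpha> = id"
  using assms by (induction il) auto

locale doubly_commuting =
  fixes k :: nat and n :: "nat \<Rightarrow> nat" and lam :: "nat \<Rightarrow> nat \<Rightarrow> nat \<Rightarrow> nat \<Rightarrow> complex"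
    and V :: "nat \<Rightarrow> nat \<Rightarrow> 'a::complex_hilbert_space \<Rightarrow> 'a"
  assumes Lambda: "Lambda_system k n lam"
    and rows: "\<forall>i\<in>{1..k}. row_isometry_on UNIV (n i) (V i)"
    and doubly_commuting: "doubly_commuting_on UNIV {1..k} n lam V"
begin

lemma row: "i \<in> {1..k} \<Longrightarrow> row_isometry (n i) (V i)"
  using rows by (simp add: row_isometry_def)

lemma bounded_op_V: "i \<in> {1..k} \<Longrightarrow> s \<in> {1..n i} \<Longrightarrow> bounded_op (V i s)"
  by (rule row_isometry.bounded_op_V [OF row])

section \<open>Commutation between different rows\<close>

lemma adj_commute:
  assumes "i \<in> {1..k}" "j \<in> {1..k}" "i \<noteq> j" "s \<in> {1..n i}" "t \<in> {1..n j}"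
  shows "adj (V i s) (V j t x) = scaleC (cnj (lam i j s t)) (V j t (adj (V i s) x))"
  using doubly_commuting assms unfolding doubly_commuting_on_def by blast

lemma Lambda_entries:
  assumes "i \<in> {1..k}" "j \<in> {1..k}" "i \<noteq> j" "s \<in> {1..n i}" "t \<in> {1..n j}"
  shows "cmod (lam i j s t) = 1" "lam j i t s = cnj (lam i j s t)"
  using Lambda assms unfolding Lambda_system_def by blast+

lemma scalar_commute_adj_V:
  assumes "i \<in> {1..k}" "j \<in> {1..k}" "i \<noteq> j" "s \<in> {1..n i}" "t \<in> {1..n j}"
  shows "scalar_commute (adj (V i s)) (V j t)"
  unfolding scalar_commute_def
  using Lambda_entries(1) [OF assms] adj_commute [OF assms]
  by (intro exI [of _ "cnj (lam i j s t)"]) auto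

text \<open>Double commutation forces \<open>V i s (V j t x)\<close> and
  \<open>scaleC (lam i j s t) (V j t (V i s x))\<close> to have inner product \<open>(norm x)\<^sup>2\<close>; both have norm \<open>norm x\<close>, so they coincide.\<close>

lemma V_commute:
  assumes "i \<in> {1..k}" "j \<in> {1..k}" "i \<noteq> j" "s \<in> {1..n i}" "t \<in> {1..n j}"
  shows "V i s (V j t x) = scaleC (lam i j s t) (V j t (V i s x))"
proof -
  interpret Vi: row_isometry "n i" "V i" by (rule row) fact
  interpret Vj: row_isometry "n j" "V j" by (rule row) fact
  define l where "l = lam i j s t"
  define u where "u = V i s (V j t x)"
  define v where "v = V j t (V i s x)"
  have l: "l * cnj l = 1"
    using Lambda_entries(1) [OF assms] by (simp add: l_def complex_norm_square [symmetric])
  have "cinner u v = cinner (adj (V j t) (V i s (V j t x))) (V i s x)"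
    unfolding u_def v_def by (rule cinner_adj_left [symmetric]) (rule bounded_op_V, fact+)
  also have "adj (V j t) (V i s (V j t x)) = scaleC l (V i s x)"
    using adj_commute [OF assms(2,1) assms(3) [symmetric] assms(5,4)] Lambda_entries(2) [OF assms]
      Vj.adj_V [OF assms(5,5)]
    by (simp add: l_def)
  finally have uv: "cinner u v = l * cinner x x"
    using Vi.cinner_V_V [OF assms(4,4)] by (simp add: cinner_scaleC_left)
  have vu: "cinner v u = cnj l * cinner x x"
    using cinner_commute [of v u] cinner_commute [of x x, symmetric] by (simp add: uv)
  have uu: "cinner u u = cinner x x" and vv: "cinner v v = cinner x x"
    using Vi.cinner_V_V [OF assms(4,4)] Vj.cinner_V_V [OF assms(5,5)] by (simp_all add: u_def v_def)
  have "cinner (u - scaleC l v) (u - scaleC l v) =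
      cinner x x - (l * cnj l) * cinner x x - (l * cnj l) * cinner x x + (l * cnj l) * cinner x x"
    by (simp add: cinner_diff_left cinner_diff_right cinner_scaleC_left cinner_scaleC_right
        uv vu uu vv mult_ac)
  then have "cinner (u - scaleC l v) (u - scaleC l v) = 0"
    by (simp add: l)
  then show ?thesis
    by (simp add: u_def v_def l_def)
qed

lemma scalar_commute_V_V:
  assumes "i \<in> {1..k}" "j \<in> {1..k}" "i \<noteq> j" "s \<in> {1..n i}" "t \<in> {1..n j}"
  shows "scalar_commute (V i s) (V j t)"
  unfolding scalar_commute_def
  using Lambda_entries(1) [OF assms] V_commute [OF assms]
  by (intro exI [of _ "lam i j s t"]) auto

text \<open>Adjoints reverse products, so \<open>V_commute\<close> enters with the two rows
  exchanged and its scalar conjugated.\<close>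

lemma scalar_commute_adj_adj:
  assumes "i \<in> {1..k}" "j \<in> {1..k}" "i \<noteq> j" "s \<in> {1..n i}" "t \<in> {1..n j}"
  shows "scalar_commute (adj (V i s)) (adj (V j t))"
proof -
  have bd: "bounded_op (V i s)" "bounded_op (V j t)"
    using assms bounded_op_V by blast+
  have "adj (V i s) (adj (V j t) x) =
      scaleC (cnj (lam j i t s)) (adj (V j t) (adj (V i s) x))" for x
    using V_commute [OF assms(2,1) assms(3) [symmetric] assms(5,4)] bd
    by - (rule cinner_extensionality,
        simp add: cinner_adj_left cinner_scaleC_left cinner_scaleC_right)
  moreover have "lam j i t s \<noteq> 0"
    using Lambda_entries(1) [OF assms(2,1) assms(3) [symmetric] assms(5,4)] by auto
  ultimately show ?thesis
    unfolding scalar_commute_def by (intro exI [of _ "cnj (lam j i t s)"]) auto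
qed

text \<open>Both \<open>V j t\<close> and its adjoint commute with every \<open>adj (V i s)\<close>
  up to a scalar, hence map the kernels of these operators into themselves.\<close>

lemma reducing_for_common_ker:
  assumes i: "i \<in> {1..k}" and j: "j \<in> {1..k}" and "i \<noteq> j" and t: "t \<in> {1..n j}"
  shows "reducing_for (common_ker (n i) (V i)) (V j t)"
proof -
  interpret Vi: row_isometry "n i" "V i" by (rule row) fact
  have bd: "bounded_op (V j t)"
    using j t by (rule bounded_op_V)
  have "adj (V i s) (T x) = 0"
    if x: "x \<in> common_ker (n i) (V i)" and s: "s \<in> {1..n i}" and T: "T \<in> {V j t, adj (V j t)}" for x s T
  proof -
    have "scalar_commute (adj (V i s)) T"
      using scalar_commute_adj_V [OF i j \<open>i \<noteq> j\<close> s t] scalar_commute_adj_adj [OF i j \<open>i \<noteq> j\<close> s t] T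
      by blast
    then obtain c where "adj (V i s) (T x) = scaleC c (T (adj (V i s) x))"
      unfolding scalar_commute_def by blast
    moreover have "T 0 = 0"
      using bounded_op_0 [OF bd] bounded_op_0 [OF bounded_op_adj [OF bd]] T by blast
    moreover have "adj (V i s) x = 0"
      using x s by (simp add: Vi.common_ker_iff)
    ultimately show ?thesis
      by simp
  qed
  then show ?thesis
    by (simp add: reducing_for_def Vi.common_ker_iff)
qed

lemma reducing_for_shift_part:
  assumes i: "i \<in> {1..k}" and j: "j \<in> {1..k}" and t: "t \<in> {1..n j}"
  shows "reducing_for (shift_part (n i) (V i)) (V j t)"
proof (cases "i = j")
  case True
  then show ?thesis
    using row_isometry.reducing_for_shift_part [OF row] assms by blast
next
  case False
  interpret Vi: row_isometry "n i" "V i" by (rule row) fact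
  have bd: "bounded_op (V j t)"
    using j t by (rule bounded_op_V)
  have ker: "reducing_for (common_ker (n i) (V i)) (V j t)"
    using assms False by (intro reducing_for_common_ker)
  have "V j t x \<in> shift_part (n i) (V i)" if "x \<in> shift_part (n i) (V i)" for x
  proof (rule Vi.shift_part_invariant [OF bd _ _ that])
    show "scalar_commute (V j t) (V i s)" if "s \<in> {1..n i}" for s
      using assms False that by (intro scalar_commute_V_V) auto
  qed (use ker in \<open>simp add: reducing_for_def\<close>)
  moreover have "adj (V j t) x \<in> shift_part (n i) (V i)" if "x \<in> shift_part (n i) (V i)" for x
  proof (rule Vi.shift_part_invariant [OF bounded_op_adj [OF bd] _ _ that])
    show "scalar_commute (adj (V j t)) (V i s)" if "s \<in> {1..n i}" for s
      using assms False that by (intro scalar_commute_adj_V) auto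
  qed (use ker in \<open>simp add: reducing_for_def\<close>)
  ultimately show ?thesis
    by (simp add: reducing_for_def)
qed

lemma reducing_for_cuntz_part:
  assumes "i \<in> {1..k}" "j \<in> {1..k}" "t \<in> {1..n j}"
  shows "reducing_for (cuntz_part (n i) (V i)) (V j t)"
  using assms
  by (simp add: row_isometry.cuntz_part_eq [OF row] reducing_for_ocompl bounded_op_V
      reducing_for_shift_part)

section \<open>Joint parts and products of words from several rows\<close>

lemma closed_csubspace_joint_part: "A \<subseteq> {1..k} \<Longrightarrow> closed_csubspace (joint_part k n V A)"
  unfolding joint_part_def
  by (intro closed_csubspace_Int closed_csubspace_INT row_isometry.closed_csubspace_shift_part
      row_isometry.closed_csubspace_cuntz_part row) auto

lemma reducing_for_joint_part:
  assumes "A \<subseteq> {1..k}" "j \<in> {1..k}" "t \<in> {1..n j}"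
  shows "reducing_for (joint_part k n V A) (V j t)"
  unfolding joint_part_def using assms
  by (intro reducing_for_Int reducing_for_INT reducing_for_shift_part reducing_for_cuntz_part) auto

lemma word_op_in_reducing:
  assumes "\<alpha> \<in> words (n i)" "\<And>s. s \<in> {1..n i} \<Longrightarrow> reducing_for M (V i s)" "x \<in> M"
  shows "word_op (V i) \<alpha> x \<in> M"
  using assms by (induction \<alpha>) (auto simp: reducing_for_def)

lemma multi_op_in_reducing:
  assumes "\<And>i. i \<in> set il \<Longrightarrow> \<alpha> i \<in> words (n i)"
    and "\<And>i s. i \<in> set il \<Longrightarrow> s \<in> {1..n i} \<Longrightarrow> reducing_for M (V i s)"
    and "x \<in> M"
  shows "multi_op V il \<alpha> x \<in> M"
  using assms(1,2)
proof (induction il)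
  case (Cons i il)
  then show ?case
    unfolding multi_op_Cons comp_apply by (intro word_op_in_reducing) simp_all
qed (simp add: assms(3))

lemma scalar_commute_words:
  assumes "i \<in> {1..k}" "j \<in> {1..k}" "i \<noteq> j" "\<alpha> \<in> words (n i)" "\<beta> \<in> words (n j)"
  shows "scalar_commute (word_op (V i) \<alpha>) (word_op (V j) \<beta>)"
proof (rule row_isometry.scalar_commute_word_op [OF row [OF assms(2)] _ assms(5)])
  fix t
  assume t: "t \<in> {1..n j}"
  have "scalar_commute (V j t) (word_op (V i) \<alpha>)"
  proof (rule row_isometry.scalar_commute_word_op [OF row [OF assms(1)] _ assms(4)])
    fix s
    assume "s \<in> {1..n i}"
    then show "scalar_commute (V j t) (V i s)"
      using assms(1-3) t by (intro scalar_commute_V_V) simp_all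
  qed
  then show "scalar_commute (word_op (V i) \<alpha>) (V j t)"
    by (rule scalar_commute_sym)
qed

lemma bounded_op_multi_op:
  assumes "set il \<subseteq> {1..k}" "\<And>i. i \<in> set il \<Longrightarrow> \<alpha> i \<in> words (n i)"
  shows "bounded_op (multi_op V il \<alpha>)"
  using assms
proof (induction il)
  case Nil
  show ?case
    unfolding multi_op_Nil by (rule bounded_op_id)
next
  case (Cons i il)
  then show ?case
    unfolding multi_op_Cons
    by (intro bounded_op_comp row_isometry.bounded_op_word_op [OF row]) simp_all
qed

text \<open>The word \<open>\<beta>\<close> travels past the factors standing before row
  \<open>i\<close>, each contributing a nonzero scalar, and merges with \<open>\<alpha> i\<close> by
  concatenation. The scalar does not depend on \<open>x\<close>.\<close>

lemma word_op_multi_op: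
  assumes "set il \<subseteq> {1..k}" "distinct il" "i \<in> set il" "\<beta> \<in> words (n i)"
    and "\<And>i. i \<in> set il \<Longrightarrow> \<alpha> i \<in> words (n i)"
  obtains c where "c \<noteq> 0" "\<And>x. word_op (V i) \<beta> (multi_op V il \<alpha> x) =
      scaleC c (multi_op V il (\<alpha>(i := \<beta> @ \<alpha> i)) x)"
proof -
  have "\<exists>c. c \<noteq> 0 \<and> (\<forall>x. word_op (V i) \<beta> (multi_op V il \<alpha> x) =
      scaleC c (multi_op V il (\<alpha>(i := \<beta> @ \<alpha> i)) x))"
    using assms
  proof (induction il)
    case (Cons j il)
    show ?case
    proof (cases "i = j")
      case True
      then show ?thesis
        using Cons.prems multi_op_fun_upd [of i il V \<alpha> "\<beta> @ \<alpha> i"]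
        by (intro exI [of _ 1]) (simp add: word_op_append scaleC_one fun_upd_same
            del: multi_op_fun_upd fun_upd_apply)
    next
      case False
      have "\<exists>c. c \<noteq> 0 \<and> (\<forall>x. word_op (V i) \<beta> (multi_op V il \<alpha> x) =
          scaleC c (multi_op V il (\<alpha>(i := \<beta> @ \<alpha> i)) x))"
        by (rule Cons.IH) (use Cons.prems False in auto)
      then obtain c where "c \<noteq> 0" and c: "\<And>x. word_op (V i) \<beta> (multi_op V il \<alpha> x) =
          scaleC c (multi_op V il (\<alpha>(i := \<beta> @ \<alpha> i)) x)"
        by blast
      have "scalar_commute (word_op (V i) \<beta>) (word_op (V j) (\<alpha> j))"
        using Cons.prems False by (intro scalar_commute_words) auto
      then obtain d where "d \<noteq> 0" and d: "\<And>x. word_op (V i) \<beta> (word_op (V j) (\<alpha> j) x) =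
          scaleC d (word_op (V j) (\<alpha> j) (word_op (V i) \<beta> x))"
        by (auto simp: scalar_commute_def)
      have "bounded_op (word_op (V j) (\<alpha> j))"
        using Cons.prems by (intro row_isometry.bounded_op_word_op [OF row]) simp_all
      then show ?thesis
        using \<open>c \<noteq> 0\<close> \<open>d \<noteq> 0\<close>
        by (intro exI [of _ "d * c"])
          (simp add: c d bounded_op_scaleC scaleC_scaleC fun_upd_other [OF False [symmetric]]
            del: fun_upd_apply)
    qed
  qed simp
  then show ?thesis
    using that by blast
qed

lemma word_op_multi_op_image:
  assumes "set il \<subseteq> {1..k}" "distinct il" "i \<in> set il" "\<beta> \<in> words (n i)"
    and "\<And>i. i \<in> set il \<Longrightarrow> \<alpha> i \<in> words (n i)" "csubspace L"
  shows "word_op (V i) \<beta> ` multi_op V il \<alpha> ` L = multi_op V il (\<alpha>(i := \<beta> @ \<alpha> i)) ` L"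
proof -
  obtain c where "c \<noteq> 0" and c: "\<And>x. word_op (V i) \<beta> (multi_op V il \<alpha> x) =
      scaleC c (multi_op V il (\<alpha>(i := \<beta> @ \<alpha> i)) x)"
    using word_op_multi_op [of il i \<beta> \<alpha>] assms(1-5) by auto
  have "bounded_op (multi_op V il (\<alpha>(i := \<beta> @ \<alpha> i)))"
    using assms by (intro bounded_op_multi_op) auto
  then have "word_op (V i) \<beta> ` multi_op V il \<alpha> ` L =
      multi_op V il (\<alpha>(i := \<beta> @ \<alpha> i)) ` scaleC c ` L"
    by (auto simp: image_image c bounded_op_scaleC)
  also have "scaleC c ` L = L"
  proof (intro equalityI subsetI)
    fix x
    assume "x \<in> L"
    then have "scaleC (inverse c) x \<in> L" "x = scaleC c (scaleC (inverse c) x)"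
      using assms(6) \<open>c \<noteq> 0\<close> by (simp_all add: csubspace_scaleC scaleC_scaleC scaleC_one)
    then show "x \<in> scaleC c ` L"
      by blast
  qed (use assms(6) in \<open>auto intro: csubspace_scaleC\<close>)
  finally show ?thesis .
qed

text \<open>Any factor can be brought to the front: the word of row \<open>i\<close> is emptied and
  \<open>\<alpha> i\<close> is then prepended to the empty word. Taking the whole space as
  \<open>L\<close> lets the vector \<open>y\<close> absorb all remaining factors and
  scalars.\<close>

lemma multi_op_eq_word_op:
  assumes "set il \<subseteq> {1..k}" "distinct il" "i \<in> set il" "\<And>i. i \<in> set il \<Longrightarrow> \<alpha> i \<in> words (n i)"
  obtains y where "multi_op V il \<alpha> x = word_op (V i) (\<alpha> i) y"
proof -
  have "multi_op V il \<alpha> ` UNIV = word_op (V i) (\<alpha> i) ` multi_op V il (\<alpha>(i := [])) ` UNIV"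
    using word_op_multi_op_image [of il i "\<alpha> i" "\<alpha>(i := [])" UNIV] assms
      closed_csubspaceD(1) [OF closed_csubspace_UNIV] by simp
  then have "multi_op V il \<alpha> x \<in> word_op (V i) (\<alpha> i) ` multi_op V il (\<alpha>(i := [])) ` UNIV"
    by blast
  then show ?thesis
    using that by blast
qed

text \<open>Leading factors that agree are isometric and cancel. At the leading row where the tuples
  differ, words of equal length have orthogonal ranges, whatever vectors stand behind them.\<close>

lemma multi_op_orthogonal_same_lengths:
  assumes "set il \<subseteq> {1..k}"
    and "\<And>i. i \<in> set il \<Longrightarrow> \<alpha> i \<in> words (n i) \<and> \<beta> i \<in> words (n i) \<and> length (\<alpha> i) = length (\<beta> i)"
    and "\<exists>i\<in>set il. \<alpha> i \<noteq> \<beta> i"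
  shows "cinner (multi_op V il \<alpha> x) (multi_op V il \<beta> y) = 0"
  using assms
proof (induction il)
  case (Cons i il)
  interpret Vi: row_isometry "n i" "V i"
    using Cons.prems by (intro row) simp
  show ?case
  proof (cases "\<alpha> i = \<beta> i")
    case True
    then have "cinner (multi_op V il \<alpha> x) (multi_op V il \<beta> y) = 0"
      using Cons.prems by (intro Cons.IH) simp_all
    then show ?thesis
      using True Cons.prems(2) [of i] Vi.cinner_word_op [of "\<beta> i"] by simp
  next
    case False
    then show ?thesis
      using Cons.prems(2) [of i] Vi.word_op_orthogonal_same_length [of "\<alpha> i" "\<beta> i"] by simp
  qed
qed simp

text \<open>Where the tuples differ, the vectors behind the words must lie in the kernel of that
  row. They do, because the later factors belong to other rows and these leave the kernel
  invariant.\<close>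

lemma multi_op_common_ker_orthogonal:
  assumes "set il \<subseteq> {1..k}" "distinct il"
    and "\<And>i. i \<in> set il \<Longrightarrow> \<alpha> i \<in> words (n i) \<and> \<beta> i \<in> words (n i)"
    and "\<exists>i\<in>set il. \<alpha> i \<noteq> \<beta> i"
    and "\<And>i. i \<in> set il \<Longrightarrow> x \<in> common_ker (n i) (V i) \<and> y \<in> common_ker (n i) (V i)"
  shows "cinner (multi_op V il \<alpha> x) (multi_op V il \<beta> y) = 0"
  using assms
proof (induction il)
  case (Cons i il)
  interpret Vi: row_isometry "n i" "V i"
    using Cons.prems by (intro row) simp
  show ?case
  proof (cases "\<alpha> i = \<beta> i")
    case True
    then have "cinner (multi_op V il \<alpha> x) (multi_op V il \<beta> y) = 0"
      using Cons.prems by (intro Cons.IH) simp_all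
    then show ?thesis
      using True Cons.prems(3) [of i] Vi.cinner_word_op [of "\<beta> i"] by simp
  next
    case False
    have red: "reducing_for (common_ker (n i) (V i)) (V j t)"
      if "j \<in> set il" "t \<in> {1..n j}" for j t
      using Cons.prems that by (intro reducing_for_common_ker) auto
    have "multi_op V il \<alpha> x \<in> common_ker (n i) (V i)"
      by (rule multi_op_in_reducing [OF _ red]) (use Cons.prems in simp_all)
    moreover have "multi_op V il \<beta> y \<in> common_ker (n i) (V i)"
      by (rule multi_op_in_reducing [OF _ red]) (use Cons.prems in simp_all)
    ultimately show ?thesis
      using Cons.prems(3) [of i] Vi.word_op_common_ker_orthogonal [of "\<alpha> i" "\<beta> i"] False by simp
  qed
qed simp

section \<open>Iteration of the one-row decompositions\<close>

lemma word_tuples_neq: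
  assumes "\<alpha> \<in> word_tuples n A" "\<beta> \<in> word_tuples n A" "\<alpha> \<noteq> \<beta>"
  shows "\<exists>i\<in>A. \<alpha> i \<noteq> \<beta> i"
  using PiE_ext [OF assms(1,2)] assms(3) by blast

lemma reducing_subset_multi_op_common_ker:
  assumes "set il \<subseteq> {1..k}" "distinct il" "closed_csubspace M"
    and "\<And>i s. i \<in> set il \<Longrightarrow> s \<in> {1..n i} \<Longrightarrow> reducing_for M (V i s)"
    and "\<And>i. i \<in> set il \<Longrightarrow> M \<subseteq> shift_part (n i) (V i)"
  shows "M \<subseteq> hilbert_sum (word_tuples n (set il))
    (\<lambda>\<alpha>. multi_op V il \<alpha> ` (M \<inter> (\<Inter>i\<in>set il. common_ker (n i) (V i))))"
  using assms
proof (induction il arbitrary: M)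
  case Nil
  \<comment> \<open>The only extensional tuple over the empty set is the constant
    \<open>undefined\<close>.\<close>
  then show ?case
    using hilbert_sum_upper [of "\<lambda>i. undefined" "word_tuples n {}" "\<lambda>\<alpha>. multi_op V [] \<alpha> ` M"] by simp
next
  case (Cons i il)
  interpret Vi: row_isometry "n i" "V i"
    using Cons.prems by (intro row) simp
  \<comment> \<open>\<open>M'\<close> still reduces the rows in \<open>il\<close>, though in general
    not row \<open>i\<close>. The induction hypothesis is needed for \<open>M'\<close> rather than
    \<open>M\<close>, so \<open>M\<close> is kept arbitrary.\<close>
  define M' where "M' = M \<inter> common_ker (n i) (V i)"
  define L where "L = M \<inter> (\<Inter>i\<in>set (i # il). common_ker (n i) (V i))"
  define H where "H = hilbert_sum (word_tuples n (set (i # il))) (\<lambda>\<alpha>. multi_op V (i # il) \<alpha> ` L)"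
  define H' where "H' = hilbert_sum (word_tuples n (set il)) (\<lambda>\<alpha>. multi_op V il \<alpha> ` L)"
  have "M' \<subseteq> hilbert_sum (word_tuples n (set il))
      (\<lambda>\<alpha>. multi_op V il \<alpha> ` (M' \<inter> (\<Inter>i\<in>set il. common_ker (n i) (V i))))"
  proof (rule Cons.IH)
    show "closed_csubspace M'"
      using Cons.prems by (simp add: M'_def closed_csubspace_Int Vi.closed_csubspace_common_ker)
    show "reducing_for M' (V j s)" if "j \<in> set il" "s \<in> {1..n j}" for j s
      unfolding M'_def using Cons.prems that
      by (intro reducing_for_Int reducing_for_common_ker) auto
    show "M' \<subseteq> shift_part (n j) (V j)" if "j \<in> set il" for j
      using Cons.prems that by (auto simp: M'_def)
  qed (use Cons.prems in auto)
  also have "M' \<inter> (\<Inter>i\<in>set il. common_ker (n i) (V i)) = L"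
    by (auto simp: M'_def L_def)
  finally have M': "M' \<subseteq> H'"
    by (simp add: H'_def)
  have H: "closed_csubspace H"
    by (simp add: H_def closed_csubspace_hilbert_sum)
  have "word_op (V i) \<alpha> z \<in> H" if \<alpha>: "\<alpha> \<in> words (n i)" and "z \<in> H'" for \<alpha> z
    using Vi.bounded_op_word_op [OF \<alpha>] H _ that(2) [unfolded H'_def]
  proof (rule bounded_op_image_hilbert_sum)
    fix \<beta> x
    assume \<beta>: "\<beta> \<in> word_tuples n (set il)" and "x \<in> multi_op V il \<beta> ` L"
    then obtain y where y: "y \<in> L" and x: "x = multi_op V il \<beta> y"
      by blast
    have "\<beta>(i := \<alpha>) \<in> word_tuples n (set (i # il))"
      using \<alpha> \<beta> by (auto simp: PiE_iff extensional_def)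
    moreover have "word_op (V i) \<alpha> x = multi_op V (i # il) (\<beta>(i := \<alpha>)) y"
      using Cons.prems x by simp
    ultimately show "word_op (V i) \<alpha> x \<in> H"
      using y hilbert_sum_upper [of "\<beta>(i := \<alpha>)" "word_tuples n (set (i # il))"
          "\<lambda>\<alpha>. multi_op V (i # il) \<alpha> ` L"]
      unfolding H_def by blast
  qed
  then have "hilbert_sum (words (n i)) (\<lambda>\<alpha>. word_op (V i) \<alpha> ` M') \<subseteq> H"
    using M' by (intro hilbert_sum_least H) auto
  moreover have "M \<subseteq> hilbert_sum (words (n i)) (\<lambda>\<alpha>. word_op (V i) \<alpha> ` M')"
    unfolding M'_def using Cons.prems by (intro Vi.reducing_subspace_of_shift_part) auto
  ultimately show ?case
    unfolding H_def L_def by blast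
qed

text \<open>On the Cuntz part of a row, words of any prescribed length can be pulled out while the
  inner vectors stay in \<open>M\<close>. The same \<open>M\<close> therefore serves for every row
  in turn.\<close>

lemma reducing_subset_multi_op_lengths:
  assumes "set jl \<subseteq> {1..k}" "distinct jl"
    and "\<And>j s. j \<in> set jl \<Longrightarrow> s \<in> {1..n j} \<Longrightarrow> reducing_for M (V j s)"
    and "\<And>j. j \<in> set jl \<Longrightarrow> M \<subseteq> cuntz_part (n j) (V j)"
  shows "M \<subseteq> hilbert_sum {\<alpha> \<in> word_tuples n (set jl). \<forall>j\<in>set jl. length (\<alpha> j) = m j}
    (\<lambda>\<alpha>. multi_op V jl \<alpha> ` M)"
  using assms
proof (induction jl)
  case Nil
  then show ?case
    using hilbert_sum_upper [of "\<lambda>i. undefined" "word_tuples n {}" "\<lambda>\<alpha>. multi_op V [] \<alpha> ` M"] by simp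
next
  case (Cons j jl)
  interpret Vj: row_isometry "n j" "V j"
    using Cons.prems by (intro row) simp
  define J where "J = (\<lambda>jl. {\<alpha> \<in> word_tuples n (set jl). \<forall>j\<in>set jl. length (\<alpha> j) = m j})"
  define H where "H = (\<lambda>jl. hilbert_sum (J jl) (\<lambda>\<alpha>. multi_op V jl \<alpha> ` M))"
  have M: "M \<subseteq> H jl"
    unfolding H_def J_def using Cons.prems by (intro Cons.IH) auto
  have H: "closed_csubspace (H (j # jl))"
    by (simp add: H_def closed_csubspace_hilbert_sum)
  have "word_op (V j) \<alpha> z \<in> H (j # jl)"
    if \<alpha>: "\<alpha> \<in> words (n j)" "length \<alpha> = m j" and "z \<in> H jl" for \<alpha> z
    using Vj.bounded_op_word_op [OF \<alpha>(1)] H _ that(3) [unfolded H_def]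
  proof (rule bounded_op_image_hilbert_sum)
    fix \<beta> x
    assume \<beta>: "\<beta> \<in> J jl" and "x \<in> multi_op V jl \<beta> ` M"
    then obtain y where y: "y \<in> M" and x: "x = multi_op V jl \<beta> y"
      by blast
    have "\<beta>(j := \<alpha>) \<in> J (j # jl)"
      using \<alpha> \<beta> by (auto simp: J_def PiE_iff extensional_def)
    moreover have "word_op (V j) \<alpha> x = multi_op V (j # jl) (\<beta>(j := \<alpha>)) y"
      using Cons.prems x by simp
    ultimately show "word_op (V j) \<alpha> x \<in> H (j # jl)"
      using y hilbert_sum_upper [of "\<beta>(j := \<alpha>)" "J (j # jl)" "\<lambda>\<alpha>. multi_op V (j # jl) \<alpha> ` M"]
      unfolding H_def by blast
  qed
  then have "hilbert_sum {\<alpha> \<in> words (n j). length \<alpha> = m j} (\<lambda>\<alpha>. word_op (V j) \<alpha> ` M) \<subseteq> H (j # jl)"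
    using M by (intro hilbert_sum_least H) auto
  moreover have "M \<subseteq> hilbert_sum {\<alpha> \<in> words (n j). length \<alpha> = m j} (\<lambda>\<alpha>. word_op (V j) \<alpha> ` M)"
  proof (rule subsetI, rule Vj.in_hilbert_sum_word_op)
    show "Vj.defect x = 0" if "x \<in> M" for x
      using Cons.prems(4) [of j] Vj.cuntz_part_sum that by (auto simp: Vj.defect_eq_0_iff)
  qed (use Cons.prems in auto)
  ultimately show ?case
    unfolding H_def J_def by blast
qed

end

section \<open>The generating subspace of a joint part\<close>

context doubly_commuting
begin

lemma closed_csubspace_INT_common_ker:
  "A \<subseteq> {1..k} \<Longrightarrow> closed_csubspace (\<Inter>i\<in>A. common_ker (n i) (V i))"
  by (intro closed_csubspace_INT row_isometry.closed_csubspace_common_ker [OF row]) blast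

lemma reducing_for_INT_common_ker:
  assumes "A \<subseteq> {1..k}" "j \<in> {1..k} - A" "t \<in> {1..n j}"
  shows "reducing_for (\<Inter>i\<in>A. common_ker (n i) (V i)) (V j t)"
  using assms by (intro reducing_for_INT reducing_for_common_ker) auto

lemma generating_subspace_subset_common_ker:
  assumes il: "distinct il" "set il \<subseteq> {1..k}" and gen: "generates_joint_part k n V il L"
    and i: "i \<in> set il"
  shows "L \<subseteq> common_ker (n i) (V i)"
proof
  define K where "K = joint_part k n V (set il)"
  have ik: "i \<in> {1..k}"
    using i il by blast
  interpret Vi: row_isometry "n i" "V i" by (rule row) fact
  have LK: "L \<subseteq> K" and K: "K = hilbert_sum (word_tuples n (set il)) (\<lambda>\<alpha>. multi_op V il \<alpha> ` L)"
    and orth: "orthogonal_family (word_tuples n (set il)) (\<lambda>\<alpha>. multi_op V il \<alpha> ` L)"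
    and L: "csubspace L"
    using gen by (auto simp: generates_joint_part_def K_def closed_csubspaceD)
  fix x
  assume x: "x \<in> L"
  \<comment> \<open>The restriction to \<open>set il\<close> makes the tuple of empty words
    extensional, so that it indexes the summand \<open>L\<close> itself.\<close>
  define \<epsilon> where "\<epsilon> = (\<lambda>j\<in>set il. [] :: nat list)"
  have \<epsilon>: "\<epsilon> \<in> word_tuples n (set il)" "multi_op V il \<epsilon> = id"
    by (auto simp: \<epsilon>_def intro: multi_op_empty_words)
  show "x \<in> common_ker (n i) (V i)"
    unfolding Vi.common_ker_iff
  proof
    fix s
    assume s: "s \<in> {1..n i}"
    have bd: "bounded_op (V i s)"
      using ik s by (rule bounded_op_V)
    have "V i s y \<in> ocompl {x}" if "y \<in> K" for y
      using bd closed_csubspace_ocompl _ that [unfolded K]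
    proof (rule bounded_op_image_hilbert_sum)
      fix \<alpha> y
      assume \<alpha>: "\<alpha> \<in> word_tuples n (set il)" and y: "y \<in> multi_op V il \<alpha> ` L"
      define \<alpha>' where "\<alpha>' = \<alpha>(i := [s] @ \<alpha> i)"
      have \<alpha>': "\<alpha>' \<in> word_tuples n (set il)"
        using \<alpha> i s by (auto simp: \<alpha>'_def PiE_iff extensional_def)
      have "\<alpha>' i \<noteq> \<epsilon> i"
        using i by (simp add: \<alpha>'_def \<epsilon>_def)
      then have "\<alpha>' \<noteq> \<epsilon>"
        by metis
      have "word_op (V i) [s] ` multi_op V il \<alpha> ` L = multi_op V il \<alpha>' ` L"
        unfolding \<alpha>'_def using il i s \<alpha> L by (intro word_op_multi_op_image) auto
      then have "V i s y \<in> multi_op V il \<alpha>' ` L"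
        using y by auto
      moreover have "x \<in> multi_op V il \<epsilon> ` L"
        using x \<epsilon> by simp
      ultimately have "cinner (V i s y) x = 0"
        using orth \<alpha>' \<epsilon>(1) \<open>\<alpha>' \<noteq> \<epsilon>\<close> unfolding orthogonal_family_def by blast
      then show "V i s y \<in> ocompl {x}"
        by (simp add: ocompl_def)
    qed
    \<comment> \<open>Since \<open>K\<close> is reducing, this vector may be inserted for
      \<open>y\<close> above; the inner product then becomes the squared norm of
      \<open>adj (V i s) x\<close>.\<close>
    moreover have "adj (V i s) x \<in> K"
      using reducing_for_joint_part [OF il(2) ik s] x LK by (auto simp: reducing_for_def K_def)
    ultimately have "cinner (V i s (adj (V i s) x)) x = 0"
      by (simp add: ocompl_def)
    then have "cinner (adj (V i s) x) (adj (V i s) x) = 0"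
      by (simp add: cinner_adj_right bd)
    then show "adj (V i s) x = 0"
      by simp
  qed
qed

lemma generating_subspace_unique:
  assumes il: "distinct il" "set il \<subseteq> {1..k}" and gen: "generates_joint_part k n V il L"
  shows "L = joint_part k n V (set il) \<inter> (\<Inter>i\<in>set il. common_ker (n i) (V i))"
proof
  define K where "K = joint_part k n V (set il)"
  have LK: "L \<subseteq> K" and K: "K = hilbert_sum (word_tuples n (set il)) (\<lambda>\<alpha>. multi_op V il \<alpha> ` L)"
    and L: "closed_csubspace L"
    using gen by (auto simp: generates_joint_part_def K_def)
  have LN: "L \<subseteq> (\<Inter>i\<in>set il. common_ker (n i) (V i))"
    using generating_subspace_subset_common_ker [OF il gen] by blast
  with LK show "L \<subseteq> joint_part k n V (set il) \<inter> (\<Inter>i\<in>set il. common_ker (n i) (V i))"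
    by (simp add: K_def)
  have sub: "csubspace (K \<inter> (\<Inter>i\<in>set il. common_ker (n i) (V i)))"
    unfolding K_def
    by (intro closed_csubspaceD(1) closed_csubspace_Int closed_csubspace_joint_part
        closed_csubspace_INT_common_ker il)
  show "joint_part k n V (set il) \<inter> (\<Inter>i\<in>set il. common_ker (n i) (V i)) \<subseteq> L"
  proof
    fix x
    assume "x \<in> joint_part k n V (set il) \<inter> (\<Inter>i\<in>set il. common_ker (n i) (V i))"
    then have x: "x \<in> K \<inter> (\<Inter>i\<in>set il. common_ker (n i) (V i))"
      by (simp add: K_def)
    obtain l u where l: "l \<in> L" and u: "u \<in> ocompl L" and xlu: "x = l + u"
      using orthogonal_decomposition [OF L, of x] by blast
    have "l \<in> K \<inter> (\<Inter>i\<in>set il. common_ker (n i) (V i))"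
      using l LK LN by blast
    from csubspace_diff [OF sub x this]
    have uK: "u \<in> K" and uN: "\<And>i. i \<in> set il \<Longrightarrow> u \<in> common_ker (n i) (V i)"
      by (auto simp: xlu)
    \<comment> \<open>At the tuple of empty words this is the choice of \<open>u\<close>. Otherwise
      a nonempty word is brought to the front, and \<open>u\<close> lies in the kernel of its
      row.\<close>
    have "cinner u (multi_op V il \<alpha> z) = 0" if \<alpha>: "\<alpha> \<in> word_tuples n (set il)" and z: "z \<in> L" for \<alpha> z
    proof (cases "\<forall>i\<in>set il. \<alpha> i = []")
      case True
      then have "multi_op V il \<alpha> = id"
        by (intro multi_op_empty_words) simp
      then show ?thesis
        using u z by (simp add: ocompl_def)
    next
      case False
      then obtain i where i: "i \<in> set il" "\<alpha> i \<noteq> []"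
        by blast
      have words: "\<And>i. i \<in> set il \<Longrightarrow> \<alpha> i \<in> words (n i)"
        using \<alpha> by (rule PiE_mem)
      obtain y where "multi_op V il \<alpha> z = word_op (V i) (\<alpha> i) y"
        using multi_op_eq_word_op [OF il(2,1) i(1) words] by blast
      moreover have "i \<in> {1..k}"
        using i il by blast
      ultimately show ?thesis
        using row_isometry.common_ker_orthogonal [OF row _ words] i uN by simp
    qed
    then have "u \<in> ocompl K"
      unfolding K ocompl_hilbert_sum by blast
    then have "u = 0"
      using uK by (rule ocompl_self_eq_0 [rotated])
    then show "x \<in> L"
      using l xlu by simp
  qed
qed

text \<open>Orthogonality of the summands comes from \<open>N\<close> alone; that they exhaust
  \<open>K\<close> comes from \<open>K\<close> being a reducing subspace of all the shift parts
  concerned.\<close>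

lemma generates_joint_part_common_ker:
  assumes il: "distinct il" "set il \<subseteq> {1..k}"
  shows "generates_joint_part k n V il
    (joint_part k n V (set il) \<inter> (\<Inter>i\<in>set il. common_ker (n i) (V i)))"
proof -
  define K where "K = joint_part k n V (set il)"
  define N where "N = (\<Inter>i\<in>set il. common_ker (n i) (V i))"
  have K: "closed_csubspace K" and redK: "\<And>j t. j \<in> {1..k} \<Longrightarrow> t \<in> {1..n j} \<Longrightarrow> reducing_for K (V j t)"
    unfolding K_def by (intro closed_csubspace_joint_part reducing_for_joint_part il; simp)+
  have "closed_csubspace (K \<inter> N)"
    unfolding N_def by (intro closed_csubspace_Int K closed_csubspace_INT_common_ker il)
  moreover have "V j t ` (K \<inter> N) \<subseteq> K \<inter> N" if "j \<in> {1..k} - set il" "t \<in> {1..n j}" for j t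
    using reducing_for_Int [OF redK reducing_for_INT_common_ker [OF il(2)], of j t] that
    by (auto simp: reducing_for_def N_def)
  moreover have "orthogonal_family (word_tuples n (set il)) (\<lambda>\<alpha>. multi_op V il \<alpha> ` (K \<inter> N))"
    unfolding orthogonal_family_def
  proof (intro ballI impI)
    fix \<alpha> \<beta> x y
    assume \<alpha>: "\<alpha> \<in> word_tuples n (set il)" and \<beta>: "\<beta> \<in> word_tuples n (set il)" and "\<alpha> \<noteq> \<beta>"
      and "x \<in> multi_op V il \<alpha> ` (K \<inter> N)" "y \<in> multi_op V il \<beta> ` (K \<inter> N)"
    then obtain v w where "v \<in> N" "w \<in> N" and xy: "x = multi_op V il \<alpha> v" "y = multi_op V il \<beta> w"
      by blast
    then show "cinner x y = 0"
      using word_tuples_neq [OF \<alpha> \<beta> \<open>\<alpha> \<noteq> \<beta>\<close>] PiE_mem [OF \<alpha>] PiE_mem [OF \<beta>] unfolding xy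
      by (intro multi_op_common_ker_orthogonal il) (auto simp: N_def)
  qed
  moreover have "K = hilbert_sum (word_tuples n (set il)) (\<lambda>\<alpha>. multi_op V il \<alpha> ` (K \<inter> N))"
  proof
    show "K \<subseteq> hilbert_sum (word_tuples n (set il)) (\<lambda>\<alpha>. multi_op V il \<alpha> ` (K \<inter> N))"
      unfolding N_def
    proof (rule reducing_subset_multi_op_common_ker [OF il(2,1) K])
      show "reducing_for K (V i s)" if "i \<in> set il" "s \<in> {1..n i}" for i s
        using redK that il by blast
      show "K \<subseteq> shift_part (n i) (V i)" if "i \<in> set il" for i
        using that by (auto simp: K_def joint_part_def)
    qed
    have "multi_op V il \<alpha> x \<in> K" if \<alpha>: "\<alpha> \<in> word_tuples n (set il)" and "x \<in> K" for \<alpha> x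
      by (rule multi_op_in_reducing [OF _ redK \<open>x \<in> K\<close>]) (use PiE_mem [OF \<alpha>] il in auto)
    then show "hilbert_sum (word_tuples n (set il)) (\<lambda>\<alpha>. multi_op V il \<alpha> ` (K \<inter> N)) \<subseteq> K"
      by (intro hilbert_sum_least K) blast
  qed
  ultimately show ?thesis
    unfolding generates_joint_part_def by (simp add: K_def N_def)
qed

section \<open>The intersection formula\<close>

lemma orthogonal_family_lengths:
  assumes "set jl \<subseteq> {1..k}"
  shows "orthogonal_family {\<alpha> \<in> word_tuples n (set jl). \<forall>j\<in>set jl. length (\<alpha> j) = m j}
    (\<lambda>\<alpha>. multi_op V jl \<alpha> ` N)"
  unfolding orthogonal_family_def
proof (intro ballI impI)
  fix \<alpha> \<beta> x y
  assume \<alpha>: "\<alpha> \<in> {\<alpha> \<in> word_tuples n (set jl). \<forall>j\<in>set jl. length (\<alpha> j) = m j}"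
    and \<beta>: "\<beta> \<in> {\<alpha> \<in> word_tuples n (set jl). \<forall>j\<in>set jl. length (\<alpha> j) = m j}"
    and "\<alpha> \<noteq> \<beta>" and "x \<in> multi_op V jl \<alpha> ` N" "y \<in> multi_op V jl \<beta> ` N"
  then obtain v w where xy: "x = multi_op V jl \<alpha> v" "y = multi_op V jl \<beta> w"
    by blast
  show "cinner x y = 0"
    unfolding xy
  proof (rule multi_op_orthogonal_same_lengths [OF assms])
    show "\<exists>i\<in>set jl. \<alpha> i \<noteq> \<beta> i"
      using word_tuples_neq \<alpha> \<beta> \<open>\<alpha> \<noteq> \<beta>\<close> by blast
  qed (use \<alpha> \<beta> in \<open>auto simp: PiE_iff\<close>)
qed

lemma joint_part_common_ker_eq:
  assumes A: "A \<subseteq> {1..k}" and jl: "distinct jl" "set jl = {1..k} - A"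
  shows "joint_part k n V A \<inter> (\<Inter>i\<in>A. common_ker (n i) (V i)) =
    (\<Inter>m. hilbert_sum {\<alpha> \<in> word_tuples n ({1..k} - A). \<forall>j\<in>{1..k} - A. length (\<alpha> j) = m j}
      (\<lambda>\<alpha>. multi_op V jl \<alpha> ` (\<Inter>i\<in>A. common_ker (n i) (V i))))"
    (is "?L = (\<Inter>m. hilbert_sum (?J m) (\<lambda>\<alpha>. multi_op V jl \<alpha> ` ?N))")
proof (intro equalityI subsetI)
  fix x
  assume x: "x \<in> ?L"
  have "?L \<subseteq> hilbert_sum (?J m) (\<lambda>\<alpha>. multi_op V jl \<alpha> ` ?L)" for m
    unfolding jl(2) [symmetric]
  proof (rule reducing_subset_multi_op_lengths [OF _ jl(1)])
    show "reducing_for ?L (V j s)" if "j \<in> set jl" "s \<in> {1..n j}" for j s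
      using that A jl
      by (intro reducing_for_Int reducing_for_joint_part reducing_for_INT_common_ker) auto
  qed (use jl in \<open>auto simp: joint_part_def\<close>)
  moreover have "hilbert_sum (?J m) (\<lambda>\<alpha>. multi_op V jl \<alpha> ` ?L) \<subseteq>
      hilbert_sum (?J m) (\<lambda>\<alpha>. multi_op V jl \<alpha> ` ?N)" for m
    by (rule hilbert_sum_mono) blast
  ultimately show "x \<in> (\<Inter>m. hilbert_sum (?J m) (\<lambda>\<alpha>. multi_op V jl \<alpha> ` ?N))"
    using x by blast
next
  fix x
  assume "x \<in> (\<Inter>m. hilbert_sum (?J m) (\<lambda>\<alpha>. multi_op V jl \<alpha> ` ?N))"
  then have x: "x \<in> hilbert_sum (?J m) (\<lambda>\<alpha>. multi_op V jl \<alpha> ` ?N)" for m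
    by blast
  \<comment> \<open>A single choice of lengths places \<open>x\<close> in \<open>?N\<close>, because
    the rows in \<open>jl\<close> leave \<open>?N\<close> invariant.\<close>
  have "hilbert_sum (?J (\<lambda>_. 0)) (\<lambda>\<alpha>. multi_op V jl \<alpha> ` ?N) \<subseteq> ?N"
  proof (rule hilbert_sum_least [OF closed_csubspace_INT_common_ker [OF A]], rule image_subsetI)
    fix \<alpha> y
    assume "\<alpha> \<in> ?J (\<lambda>_. 0)" and y: "y \<in> ?N"
    then have \<alpha>: "\<alpha> \<in> word_tuples n (set jl)"
      using jl by simp
    show "multi_op V jl \<alpha> y \<in> ?N"
      using PiE_mem [OF \<alpha>] _ y
    proof (rule multi_op_in_reducing)
      show "reducing_for ?N (V i s)" if "i \<in> set jl" "s \<in> {1..n i}" for i s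
        using that A jl by (intro reducing_for_INT_common_ker) auto
    qed
  qed
  then have xN: "x \<in> ?N"
    using x [of "\<lambda>_. 0"] by (rule subsetD)
  then have "x \<in> shift_part (n i) (V i)" if "i \<in> A" for i
    using row_isometry.common_ker_subset_shift_part [OF row] that A by blast
  moreover have "x \<in> cuntz_part (n j) (V j)" if j: "j \<in> {1..k} - A" for j
    unfolding cuntz_part_def
  proof
    fix p
    \<comment> \<open>Constant lengths \<open>p\<close> suffice: the factor of row \<open>j\<close>
      is moved to the front and everything behind it is treated as an arbitrary vector.\<close>
    have "hilbert_sum (?J (\<lambda>_. p)) (\<lambda>\<alpha>. multi_op V jl \<alpha> ` ?N) \<subseteq>
        hilbert_sum {\<alpha> \<in> words (n j). length \<alpha> = p} (\<lambda>\<alpha>. word_op (V j) \<alpha> ` UNIV)"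
    proof (rule hilbert_sum_mono)
      fix \<alpha> y
      assume \<alpha>: "\<alpha> \<in> ?J (\<lambda>_. p)" and "y \<in> multi_op V jl \<alpha> ` ?N"
      then obtain z where z: "y = multi_op V jl \<alpha> z"
        by blast
      have words: "\<And>i. i \<in> set jl \<Longrightarrow> \<alpha> i \<in> words (n i)"
        using \<alpha> jl(2) by (simp add: PiE_iff)
      obtain w where "y = word_op (V j) (\<alpha> j) w"
        using multi_op_eq_word_op [of jl j \<alpha> z, OF _ jl(1) _ words] j jl(2) z by auto
      moreover have "\<alpha> j \<in> words (n j)" "length (\<alpha> j) = p"
        using words \<alpha> j jl(2) by auto
      ultimately show "\<exists>\<beta>\<in>{\<alpha> \<in> words (n j). length \<alpha> = p}. y \<in> word_op (V j) \<beta> ` UNIV"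
        by (intro bexI [of _ "\<alpha> j"]) auto
    qed
    then show "x \<in> hilbert_sum {\<alpha> \<in> words (n j). length \<alpha> = p} (\<lambda>\<alpha>. word_op (V j) \<alpha> ` UNIV)"
      using x [of "\<lambda>_. p"] by (rule subsetD)
  qed
  ultimately show "x \<in> ?L"
    using xN by (simp add: joint_part_def)
qed

text \<open>On a reducing subspace the relative adjoints agree with the global ones, so the isometry
  relations are inherited; the sum condition comes from vanishing defects on the Cuntz part.\<close>

lemma cuntz_row_isometry_on_reducing:
  assumes M: "closed_csubspace M" and i: "i \<in> {1..k}"
    and red: "\<And>s. s \<in> {1..n i} \<Longrightarrow> reducing_for M (V i s)"
    and "M \<subseteq> cuntz_part (n i) (V i)"
  shows "cuntz_row_isometry_on M (n i) (V i)"
proof -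
  interpret Vi: row_isometry "n i" "V i" by (rule row) fact
  have adj: "adj_on M (V i s) x = adj (V i s) x" if "s \<in> {1..n i}" "x \<in> M" for s x
    using adj_on_reducing [OF M bounded_op_V [OF i] red] that by blast
  have inv: "V i s x \<in> M" if "s \<in> {1..n i}" "x \<in> M" for s x
    using red [OF that(1)] that(2) by (simp add: reducing_for_def)
  have "bounded_op_on M (V i s)" if "s \<in> {1..n i}" for s
    using bounded_op_V [OF i that] inv [OF that] by (auto simp: bounded_op_on_def)
  moreover have "adj_on M (V i s) (V i t x) = (if s = t then x else 0)"
    if "s \<in> {1..n i}" "t \<in> {1..n i}" "x \<in> M" for s t x
    using adj [OF that(1) inv [OF that(2,3)]] Vi.adj_V [OF that(1,2)] by simp
  moreover have "(\<Sum>s\<in>{1..n i}. V i s (adj_on M (V i s) x)) = x" if "x \<in> M" for x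
  proof -
    have "(\<Sum>s\<in>{1..n i}. V i s (adj_on M (V i s) x)) = (\<Sum>s\<in>{1..n i}. V i s (adj (V i s) x))"
      by (rule sum.cong) (simp_all only: adj that)
    also have "\<dots> = x"
      using assms(4) that by (intro Vi.cuntz_part_sum) blast
    finally show ?thesis .
  qed
  ultimately show ?thesis
    by (simp add: cuntz_row_isometry_on_def row_isometry_on_def)
qed

lemma doubly_commuting_on_reducing:
  assumes M: "closed_csubspace M" and S: "S \<subseteq> {1..k}"
    and red: "\<And>i s. i \<in> S \<Longrightarrow> s \<in> {1..n i} \<Longrightarrow> reducing_for M (V i s)"
  shows "doubly_commuting_on M S n lam V"
  unfolding doubly_commuting_on_def
proof (intro ballI impI)
  fix i j s t x
  assume ij: "i \<in> S" "j \<in> S" "i \<noteq> j" and s: "s \<in> {1..n i}" and t: "t \<in> {1..n j}" and x: "x \<in> M"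
  have "V j t x \<in> M"
    using red [OF ij(2) t] x by (simp add: reducing_for_def)
  moreover have ijk: "i \<in> {1..k}" "j \<in> {1..k}"
    using ij S by auto
  moreover have "adj_on M (V i s) y = adj (V i s) y" if "y \<in> M" for y
    using M bounded_op_V [OF ijk(1) s] red [OF ij(1) s] that by (rule adj_on_reducing)
  ultimately show "adj_on M (V i s) (V j t x) =
      scaleC (cnj (lam i j s t)) (V j t (adj_on M (V i s) x))"
    using adj_commute [OF ijk ij(3) s t, of x] x by simp
qed

end

theorem theorem1p9:
  fixes k :: nat
    and n :: "nat \<Rightarrow> nat"
    and lam :: "nat \<Rightarrow> nat \<Rightarrow> nat \<Rightarrow> nat \<Rightarrow> complex"
    and V :: "nat \<Rightarrow> nat \<Rightarrow> 'a::complex_hilbert_space \<Rightarrow> 'a"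
    and A :: "nat set"
    and il jl :: "nat list"
  assumes "k \<ge> 1"
    and "\<forall>i\<in>{1..k}. n i \<ge> 1"
    and "Lambda_system k n lam"
    and "\<forall>i\<in>{1..k}. row_isometry_on UNIV (n i) (V i)"
    and "doubly_commuting_on UNIV {1..k} n lam V"
    and "A \<subseteq> {1..k}"
    and "distinct il" and "set il = A"
    and "distinct jl" and "set jl = {1..k} - A"
  shows "(\<exists>!L. generates_joint_part k n V il L) \<and>
    (\<forall>L. generates_joint_part k n V il L \<longrightarrow>
      (let
         N = (\<Inter>i\<in>A. common_ker (n i) (V i));
         J = (\<lambda>m. {\<alpha> \<in> word_tuples n ({1..k} - A). \<forall>j\<in>{1..k} - A. length (\<alpha> j) = m j});
         F = (\<lambda>\<alpha>. multi_op V jl \<alpha> ` N)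
       in (\<forall>m::nat \<Rightarrow> nat. orthogonal_family (J m) F) \<and>
          L = (\<Inter>m::nat \<Rightarrow> nat. hilbert_sum (J m) F)) \<and>
      (\<forall>i\<in>{1..k} - A.
         (\<forall>m\<in>{1..n i}. reducing_for L (V i m)) \<and> cuntz_row_isometry_on L (n i) (V i)) \<and>
      doubly_commuting_on L ({1..k} - A) n lam V \<and>
      (\<forall>i\<in>A. L \<subseteq> common_ker (n i) (V i)) \<and>
      (\<forall>r<length il. \<forall>\<alpha>\<in>word_tuples n A. \<forall>\<beta>\<in>words (n (il ! r)).
         word_op (V (il ! r)) \<beta> ` (multi_op V il \<alpha> ` L) =
         multi_op V il (\<alpha>(il ! r := \<beta> @ \<alpha> (il ! r))) ` L))"
proof (intro conjI allI impI)
  interpret doubly_commuting k n lam V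
    using assms by unfold_locales
  have il: "distinct il" "set il \<subseteq> {1..k}"
    using assms by auto
  \<comment> \<open>Uniqueness identifies every generating \<open>L\<close> with this explicit
    intersection, from which the remaining claims can be read off.\<close>
  define L0 where "L0 = joint_part k n V A \<inter> (\<Inter>i\<in>A. common_ker (n i) (V i))"
  have gen: "generates_joint_part k n V il L0"
    using generates_joint_part_common_ker [OF il] by (simp add: L0_def assms)
  have unique: "L = L0" if "generates_joint_part k n V il L" for L
    using generating_subspace_unique [OF il that] by (simp add: L0_def assms)
  show "\<exists>!L. generates_joint_part k n V il L"
    using gen unique by blast
  fix L
  assume "generates_joint_part k n V il L"
  then have L: "L = L0"
    by (rule unique)
  have closed: "closed_csubspace L"
    using gen by (simp add: L generates_joint_part_def)
  \<comment> \<open>For \<open>i\<close> outside \<open>A\<close>, every kernel in the intersection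
    belongs to a row different from \<open>i\<close>.\<close>
  have red: "reducing_for L (V i m)" if "i \<in> {1..k} - A" "m \<in> {1..n i}" for i m
    unfolding L L0_def using that assms(6)
    by (intro reducing_for_Int reducing_for_joint_part reducing_for_INT_common_ker) auto
  show "let
         N = (\<Inter>i\<in>A. common_ker (n i) (V i));
         J = (\<lambda>m. {\<alpha> \<in> word_tuples n ({1..k} - A). \<forall>j\<in>{1..k} - A. length (\<alpha> j) = m j});
         F = (\<lambda>\<alpha>. multi_op V jl \<alpha> ` N)
       in (\<forall>m::nat \<Rightarrow> nat. orthogonal_family (J m) F) \<and>
          L = (\<Inter>m::nat \<Rightarrow> nat. hilbert_sum (J m) F)"
    unfolding Let_def
  proof (intro conjI allI)
    show "orthogonal_family
        {\<alpha> \<in> word_tuples n ({1..k} - A). \<forall>j\<in>{1..k} - A. length (\<alpha> j) = m j}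
        (\<lambda>\<alpha>. multi_op V jl \<alpha> ` (\<Inter>i\<in>A. common_ker (n i) (V i)))" for m
      unfolding assms(10) [symmetric] by (rule orthogonal_family_lengths) (use assms(10) in blast)
    show "L = (\<Inter>m. hilbert_sum
        {\<alpha> \<in> word_tuples n ({1..k} - A). \<forall>j\<in>{1..k} - A. length (\<alpha> j) = m j}
        (\<lambda>\<alpha>. multi_op V jl \<alpha> ` (\<Inter>i\<in>A. common_ker (n i) (V i))))"
      unfolding L L0_def using assms by (intro joint_part_common_ker_eq)
  qed
  show "\<forall>i\<in>{1..k} - A.
      (\<forall>m\<in>{1..n i}. reducing_for L (V i m)) \<and> cuntz_row_isometry_on L (n i) (V i)"
  proof (intro ballI conjI)
    fix i
    assume i: "i \<in> {1..k} - A"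
    then show "reducing_for L (V i m)" if "m \<in> {1..n i}" for m
      using red that by blast
    have "L \<subseteq> cuntz_part (n i) (V i)"
      using i by (auto simp: L L0_def joint_part_def)
    with i show "cuntz_row_isometry_on L (n i) (V i)"
      using cuntz_row_isometry_on_reducing [OF closed _ red] by blast
  qed
  show "doubly_commuting_on L ({1..k} - A) n lam V"
    using closed _ red by (rule doubly_commuting_on_reducing) blast+
  show "\<forall>i\<in>A. L \<subseteq> common_ker (n i) (V i)"
    by (auto simp: L L0_def)
  fix r
  assume "r < length il"
  then have r: "il ! r \<in> set il"
    by simp
  show "\<forall>\<alpha>\<in>word_tuples n A. \<forall>\<beta>\<in>words (n (il ! r)).
      word_op (V (il ! r)) \<beta> ` (multi_op V il \<alpha> ` L) =
      multi_op V il (\<alpha>(il ! r := \<beta> @ \<alpha> (il ! r))) ` L"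
  proof (intro ballI)
    fix \<alpha> \<beta>
    assume \<alpha>: "\<alpha> \<in> word_tuples n A" and \<beta>: "\<beta> \<in> words (n (il ! r))"
    show "word_op (V (il ! r)) \<beta> ` (multi_op V il \<alpha> ` L) =
        multi_op V il (\<alpha>(il ! r := \<beta> @ \<alpha> (il ! r))) ` L"
      using PiE_mem [OF \<alpha>] assms(8) closed
      by (intro word_op_multi_op_image [OF il(2,1) r \<beta>]) (auto simp: closed_csubspaceD)
  qed
qed

end
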